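(* Let $b^* := 2\left(b-\tfrac34\right)$. For any $\alpha\in\mathbb{N}$, any $\mu,\nu\in\mathbb{C}$ and any $z\in\mathbb{C}$ with $|z|<1$, the second-order correlation function $f(n,m)=f(n,m;\mu,\nu)$ of the characteristic polynomial of an unrescaled complex sample covariance matrix satisfies $$ \sum_{m=0}^{\infty} \frac{f(m+\alpha,m)}{(m+\alpha)!\,m!}\, z^m = \exp\left(-(\mu+\nu)\frac{z}{1-z}+b^*z\right)\sum_{k=0}^{\infty}\frac{(\mu\nu z)^k}{(k+\alpha)!\,k!}\,(1-z)^{-2k-\alpha-2}. $$
   Context: Here $\mathbb{N}=\{0,1,2,\dots\}$. Let $Q$ be a probability distribution on the real line with expectation $0$, variance $1/2$ and finite fourth moment $b$ (i.e. $b=\int x^4\,dQ(x)<\infty$). For $n,m\in\mathbb{N}$ with $n\ge m$, let $X=X(n,m)=(X_{ij})_{i=1,\dots,n;\,j=1,\dots,m}$ be the $n\times m$ random matrix whose entries are i.i.d. complex random variables whose real and imaginary parts are independent, each with distribution $Q$. Let $X^*$ be the conjugate transpose of $X$; the $m\times m$ matrix $X(n,m)^*X(n,m)$ is the unrescaled complex sample covariance matrix associated with $Q$. For $\mu,\nu\in\mathbb{C}$ the second-order correlation function of its characteristic polynomial is $$ f(n,m;\mu,\nu):=\mathbb{E}\big(\det(X(n,m)^*X(n,m)-\mu)\,\det(X(n,m)^*X(n,m)-\nu)\big), $$ where $\mu,\nu$ inside the determinants stand for $\mu I_m,\nu I_m$. The determinant of the $0\times0$ matrix is defined to be $1$, so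 $f(n,0;\mu,\nu)=1$. *)

theory Defs
  imports
    "HOL-Probability.Probability"
    "Jordan_Normal_Form.Determinant"
    "Jordan_Normal_Form.Schur_Decomposition"
begin

(* HOL-Analysis and Jordan_Normal_Form both have constants mat and det; the formulas below
   use the variable-size matrices of Jordan_Normal_Form (0-based indices), so the
   determinant is written Determinant.det.  It is 1 for the 0 x 0 matrix. *)

(* X is an n x m matrix of i.i.d. complex random variables on M whose real and imaginary
   parts are independent with law Q.  That the entries are identically distributed follows
   from the last three clauses. *)
definition iid_complex_matrix ::
  "real measure \<Rightarrow> 'w measure \<Rightarrow> nat \<Rightarrow> nat \<Rightarrow> ('w \<Rightarrow> complex mat) \<Rightarrow> bool"
where
  "iid_complex_matrix Q M n m X \<longleftrightarrow>
     prob_space M \<and>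
     (\<forall>w\<in>space M. X w \<in> carrier_mat n m) \<and>
     prob_space.indep_vars M (\<lambda>_. borel) (\<lambda>(i, j) w. X w $$ (i, j)) ({..<n} \<times> {..<m}) \<and>
     (\<forall>i<n. \<forall>j<m.
        prob_space.indep_var M borel (\<lambda>w. Re (X w $$ (i, j))) borel (\<lambda>w. Im (X w $$ (i, j))) \<and>
        distr M borel (\<lambda>w. Re (X w $$ (i, j))) = Q \<and>
        distr M borel (\<lambda>w. Im (X w $$ (i, j))) = Q)"

definition sample_covariance :: "complex mat \<Rightarrow> complex mat" where
  "sample_covariance A = mat_adjoint A * A"

definition det_shift :: "complex mat \<Rightarrow> complex \<Rightarrow> complex" where
  "det_shift A \<mu> = Determinant.det (A - \<mu> \<cdot>\<^sub>m 1\<^sub>m (dim_row A))"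

(* The second-order correlation function f(n,m;mu,nu) when X is the n x m random matrix;
   n and m enter only through the dimensions of X. *)
definition correlation ::
  "'w measure \<Rightarrow> ('w \<Rightarrow> complex mat) \<Rightarrow> complex \<Rightarrow> complex \<Rightarrow> complex"
where
  "correlation M X \<mu> \<nu> =
     (LINT w|M. det_shift (sample_covariance (X w)) \<mu> * det_shift (sample_covariance (X w)) \<nu>)"

end

theory Submission
  imports Defs
begin

text \<open>
  Fix the number m of columns and add the rows of X one at a time. A new row v changes B = X* X by
  the rank-one matrix v* v, so det(B - \<mu>) changes by a linear form in v* v with coefficients the
  cofactors of B - \<mu>. Averaging the product of two such determinants over v only involves the
  moments E(cnj(v i) v j) and E(cnj(v i) v j cnj(v k) v l), the latter being the Gaussian pairings
  plus bstar times the indicator of i = j = k = l. The traces of adjugates which appear are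
  derivatives in \<mu> and \<nu>, the trace of adj(B - \<mu>) adj(B - \<nu>) is a divided difference by the
  resolvent identity, and the bstar term is a sum over the deletions of one column. Hence
  f(n + 1, m) = ((1 - \<partial>\<mu>)(1 - \<partial>\<nu>) - (\<partial>\<mu> - \<partial>\<nu>)/(\<mu> - \<nu>)) f(n, m) + bstar m f(n, m - 1)
  with f(0, m) = (\<mu> \<nu>)^m, where n < m is allowed. The recursion is solved explicitly in terms
  of \<mu> + \<nu> and \<mu> \<nu>, and the resulting coefficients are summed to the generating function.
\<close>

section \<open>Rank-one updates and adjugates\<close>

text \<open>Division by \<mu> - \<nu> is what forces the variables s = \<mu> + \<nu> and p = \<mu>
  \<nu>: for F depending on s and p the chain rule gives \<partial>\<mu> F - \<partial>\<nu> F =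
  (\<nu> - \<mu>) F_p, so the divided difference is just -F_p and the operator has polynomial
  coefficients in s and p. The induction on n starts at n = 0, so it passes through n < m; these
  cases are realised inside the given matrix by its first rows and a selection of its columns.
  Fourth moments suffice although a determinant of size m has high degree: a single row v enters
  only linearly through the products cnj(v i) v j, so a product of two determinants has degree four
  in each row, and the rows are independent. After division by n! m! the bstar term links (n + 1, m)
  to (n, m - 1). Both have the same \<alpha> = n - m, and lowering m by one is a factor z in the
  generating function; this is the source of exp(bstar z).\<close>

lemma det_rank_one_update:
  fixes A :: "'a::idom mat"
  assumes A: "A \<in> carrier_mat m m"
  shows "Determinant.det (Matrix.mat m m (\<lambda>(i, j). A $$ (i, j) + u i * v j)) =
    Determinant.det A + (\<Sum>i<m. \<Sum>j<m. u i * v j * cofactor A i j)"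
proof -
  \<comment> \<open>Bordering A by the column -u, the row v and the corner 1 gives K; the unipotent
    L clears the lower left block and turns A into A + u v. Nothing is inverted, so A may be
    singular.\<close>
  define U where "U = Matrix.mat m 1 (\<lambda>(i, j). - u i)"
  define V where "V = Matrix.mat 1 m (\<lambda>(i, j). v j)"
  define K where "K = four_block_mat A U V (1\<^sub>m 1)"
  define L where "L = four_block_mat (1\<^sub>m m) (0\<^sub>m m 1) (- V) (1\<^sub>m 1)"
  define B where "B = Matrix.mat m m (\<lambda>(i, j). A $$ (i, j) + u i * v j)"
  have [simp]: "U \<in> carrier_mat m 1" "V \<in> carrier_mat 1 m" "B \<in> carrier_mat m m"
    by (auto simp: U_def V_def B_def)
  then have [simp]: "U \<in> carrier_mat m (Suc 0)" "V \<in> carrier_mat (Suc 0) m"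
    by simp_all
  have K: "K \<in> carrier_mat (Suc m) (Suc m)"
    unfolding K_def using A by auto
  have L: "L \<in> carrier_mat (Suc m) (Suc m)"
    unfolding L_def by auto
  have "K * L = four_block_mat (A * 1\<^sub>m m + U * (- V)) (A * 0\<^sub>m m 1 + U * 1\<^sub>m 1)
      (V * 1\<^sub>m m + 1\<^sub>m 1 * (- V)) (V * 0\<^sub>m m 1 + 1\<^sub>m 1 * 1\<^sub>m 1)"
    unfolding K_def L_def
    by (rule mult_four_block_mat[of _ m m _ 1 _ 1]) (use A in auto)
  also have "A * 1\<^sub>m m + U * (- V) = B"
    by (rule eq_matI) (use A in \<open>auto simp: U_def V_def B_def scalar_prod_def\<close>)
  also have "A * 0\<^sub>m m 1 + U * 1\<^sub>m 1 = U"
    using A right_mult_one_mat[of U m 1] by auto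
  also have "V * 1\<^sub>m m + 1\<^sub>m 1 * (- V) = 0\<^sub>m 1 m"
    by (rule eq_matI) (auto simp: V_def)
  also have "V * 0\<^sub>m m 1 + 1\<^sub>m 1 * 1\<^sub>m 1 = 1\<^sub>m 1"
    by (rule eq_matI) (auto simp: V_def)
  finally have "Determinant.det (K * L) = Determinant.det B"
    by (simp add: det_four_block_mat_lower_left_zero[of _ m _ 1])
  moreover have "Determinant.det L = 1"
    unfolding L_def by (subst det_four_block_mat_upper_right_zero[of _ m _ 1]) auto
  ultimately have "Determinant.det B = Determinant.det K"
    using det_mult[OF K L] by simp
  also have "\<dots> = (\<Sum>j<Suc m. K $$ (m, j) * cofactor K m j)"
    by (rule laplace_expansion_row[OF K]) simp
  also have "\<dots> = (\<Sum>j<m. v j * cofactor K m j) + Determinant.det A"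
  proof -
    have "mat_delete K m m = A"
      by (rule eq_matI) (use A in \<open>auto simp: mat_delete_def K_def\<close>)
    then have "cofactor K m m = Determinant.det A"
      by (simp add: cofactor_def)
    moreover have "K $$ (m, m) = 1" and "j < m \<Longrightarrow> K $$ (m, j) = v j" for j
      using A by (auto simp: K_def V_def)
    ultimately show ?thesis by simp
  qed
  also have "(\<Sum>j<m. v j * cofactor K m j) = (\<Sum>j<m. v j * (\<Sum>i<m. u i * cofactor A i j))"
  proof (rule sum.cong[OF refl])
    fix j assume "j \<in> {..<m}"
    then have j: "j < m" by simp
    \<comment> \<open>Removing the last row and column j of K leaves A without its column j,
      followed by the column -u. Expanding along that last column leads to the minors of A.\<close>
    define C where "C = mat_delete K m j"
    have C: "C \<in> carrier_mat m m"
      using mat_delete_carrier[OF K] by (simp add: C_def)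
    have "Determinant.det C = (\<Sum>i<m. C $$ (i, m - 1) * cofactor C i (m - 1))"
      by (rule laplace_expansion_column[OF C]) (use j in simp)
    also have "\<dots> = (\<Sum>i<m. - u i * ((- 1) ^ (i + (m - 1)) * Determinant.det (mat_delete A i j)))"
    proof (rule sum.cong[OF refl])
      fix i assume "i \<in> {..<m}"
      then have i: "i < m" by simp
      have "C $$ (i, m - 1) = - u i"
        using i j A by (auto simp: C_def mat_delete_def K_def U_def)
      moreover have "mat_delete C i (m - 1) = mat_delete A i j"
        by (rule eq_matI) (use i j A in \<open>auto simp: C_def mat_delete_def K_def\<close>)
      ultimately show "C $$ (i, m - 1) * cofactor C i (m - 1) =
          - u i * ((- 1) ^ (i + (m - 1)) * Determinant.det (mat_delete A i j))"
        by (simp add: cofactor_def)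
    qed
    finally have "cofactor K m j = (\<Sum>i<m. (- 1) ^ (m + j) *
        (- u i * ((- 1) ^ (i + (m - 1)) * Determinant.det (mat_delete A i j))))"
      by (simp add: cofactor_def C_def sum_distrib_left)
    also have "\<dots> = (\<Sum>i<m. u i * cofactor A i j)"
    proof (rule sum.cong[OF refl])
      fix i
      \<comment> \<open>The two expansions contribute the exponents m + j and i + (m - 1), together
        of the parity of i + j + 1; the surplus sign cancels the minus in U.\<close>
      have "(- 1 :: 'a) ^ (m + j) * (- 1) ^ (i + (m - 1)) = (- 1) ^ (2 * (m - 1)) * (- 1) ^ (i + j + 1)"
        unfolding power_add[symmetric] using j by (intro arg_cong[of _ _ "(^) _"]) auto
      also have "\<dots> = - ((- 1) ^ (i + j))"
        by (simp add: power_mult)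
      finally have sgn: "(- 1 :: 'a) ^ (m + j) * (- 1) ^ (i + (m - 1)) = - ((- 1) ^ (i + j))" .
      have "(- 1) ^ (m + j) * (- u i * ((- 1) ^ (i + (m - 1)) * Determinant.det (mat_delete A i j)))
          = ((- 1) ^ (m + j) * (- 1) ^ (i + (m - 1))) * (- u i * Determinant.det (mat_delete A i j))"
        by (simp only: ac_simps)
      then show "(- 1) ^ (m + j) * (- u i * ((- 1) ^ (i + (m - 1)) * Determinant.det (mat_delete A i j)))
          = u i * cofactor A i j"
        unfolding sgn by (simp add: cofactor_def ac_simps)
    qed
    finally show "v j * cofactor K m j = v j * (\<Sum>i<m. u i * cofactor A i j)" by simp
  qed
  also have "\<dots> = (\<Sum>i<m. \<Sum>j<m. u i * v j * cofactor A i j)"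
    by (subst sum.swap) (simp add: sum_distrib_left ac_simps)
  finally show ?thesis
    by (simp add: B_def add.commute)
qed

text \<open>This is adj(A) (A + dI) adj(A + dI) - adj(A) A adj(A + dI) = d adj(A) adj(A + dI), traced.\<close>
lemma trace_adj_mult_adj_shift:
  fixes A :: "'a::comm_ring_1 mat"
  assumes A: "A \<in> carrier_mat m m" and A': "A' = A + d \<cdot>\<^sub>m 1\<^sub>m m"
  shows "d * (\<Sum>i<m. \<Sum>j<m. cofactor A i j * cofactor A' j i) =
    Determinant.det A' * (\<Sum>i<m. cofactor A i i) - Determinant.det A * (\<Sum>i<m. cofactor A' i i)"
proof -
  have C: "A' \<in> carrier_mat m m"
    using A A' by auto
  note adj = adj_mat[OF A] and adj' = adj_mat[OF C]
  have "adj_mat A * (A' * adj_mat A') = Determinant.det A' \<cdot>\<^sub>m adj_mat A"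
    unfolding adj'(2) using adj(1) by (simp add: mult_smult_distrib[of _ m m _ m])
  moreover have "adj_mat A * (A' * adj_mat A') =
      Determinant.det A \<cdot>\<^sub>m adj_mat A' + d \<cdot>\<^sub>m (adj_mat A * adj_mat A')"
  proof -
    have "adj_mat A * (A' * adj_mat A') = (adj_mat A * A') * adj_mat A'"
      by (rule assoc_mult_mat[symmetric, OF adj(1) C adj'(1)])
    also have "adj_mat A * A' = Determinant.det A \<cdot>\<^sub>m 1\<^sub>m m + d \<cdot>\<^sub>m adj_mat A"
      unfolding A' using adj A
      by (subst mult_add_distrib_mat[of _ m m _ m]) (auto simp: mult_smult_distrib[of _ m m _ m])
    also have "\<dots> * adj_mat A' = Determinant.det A \<cdot>\<^sub>m adj_mat A' + d \<cdot>\<^sub>m (adj_mat A * adj_mat A')"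
      using adj(1) adj'(1)
      by (subst add_mult_distrib_mat[of _ m m _ _ m]) (auto simp: mult_smult_assoc_mat[of _ m m _ m])
    finally show ?thesis .
  qed
  ultimately have eq: "Determinant.det A' \<cdot>\<^sub>m adj_mat A =
      Determinant.det A \<cdot>\<^sub>m adj_mat A' + d \<cdot>\<^sub>m (adj_mat A * adj_mat A')" by simp
  have diag: "Determinant.det A' * cofactor A i i =
      Determinant.det A * cofactor A' i i + d * (\<Sum>j<m. cofactor A j i * cofactor A' i j)"
    if "i < m" for i
  proof -
    have "(adj_mat A * adj_mat A') $$ (i, i) = (\<Sum>j<m. cofactor A j i * cofactor A' i j)"
      using that A C by (auto simp: adj_mat_def scalar_prod_def lessThan_atLeast0 intro!: sum.cong)
    then show ?thesis
      using arg_cong[OF eq, of "\<lambda>T. T $$ (i, i)"] that A C adj(1) adj'(1)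
      by (simp add: adj_mat_def)
  qed
  have "d * (\<Sum>i<m. \<Sum>j<m. cofactor A i j * cofactor A' j i) =
      (\<Sum>i<m. d * (\<Sum>j<m. cofactor A j i * cofactor A' i j))"
    by (subst sum.swap) (simp add: sum_distrib_left)
  also have "\<dots> = (\<Sum>i<m. Determinant.det A' * cofactor A i i - Determinant.det A * cofactor A' i i)"
    by (rule sum.cong[OF refl]) (simp add: diag)
  finally show ?thesis
    by (simp add: sum_subtractf sum_distrib_left)
qed

section \<open>Solution of the recursion\<close>

text \<open>The value 1/x!, extended by 0 to negative integers, so that the recursion for the
  coefficients below needs no boundary cases.\<close>
definition inv_fact :: "int \<Rightarrow> complex" where
  "inv_fact x = rGamma (of_int x + 1)"

text \<open>1/Gamma is entire, so the recurrence holds at x = 0 as well, where both sides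
  vanish.\<close>

lemma inv_fact_rec: "inv_fact (x - 1) = of_int x * inv_fact x"
  unfolding inv_fact_def using rGamma_plus1[of "of_int x :: complex"] by simp

lemma inv_fact_of_nat: "inv_fact (int n) = 1 / fact n"
  unfolding inv_fact_def
  using Gamma_fact[of n, where 'a = complex] by (simp add: rGamma_inverse_Gamma add.commute field_simps)

lemma inv_fact_neg:
  assumes "x < 0"
  shows "inv_fact x = 0"
proof -
  have "of_int (x + 1) \<in> (\<int>\<^sub>\<le>\<^sub>0 :: complex set)"
    using assms by (intro nonpos_Ints_of_int) simp
  then show ?thesis
    by (simp add: inv_fact_def rGamma_eq_zero_iff)
qed

text \<open>For \<open>bstar = 0\<close>, expanding the right-hand side of the theorem in powers of
  \<open>s = \<mu> + \<nu>\<close>, \<open>p = \<mu> \<nu>\<close> and \<open>z\<close> gives this coefficient of \<open>s^j p^k z^m\<close>, with \<open>\<alpha> = n - m\<close>.\<close>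
definition gauss_coeff :: "nat \<Rightarrow> int \<Rightarrow> nat \<Rightarrow> nat \<Rightarrow> complex" where
  "gauss_coeff n m j k = (-1) ^ j * fact (n + k + 1) / (fact j * fact k) *
     inv_fact (int n - m + int k) * inv_fact (m - int j - int k) * inv_fact (int n - m + 2 * int k + int j + 1)"

text \<open>The operator \<open>rec_op\<close> read on the coefficients of s^j p^k. It acts on
  arbitrary functions of j and k, so the explicit coefficients can be checked before any polynomial
  is built.\<close>

definition rec_coeff :: "(nat \<Rightarrow> nat \<Rightarrow> complex) \<Rightarrow> nat \<Rightarrow> nat \<Rightarrow> complex" where
  "rec_coeff a j k = a j k - 2 * of_nat (j + 1) * a (j + 1) k
     - (if j = 0 then 0 else of_nat (k + 1) * a (j - 1) (k + 1))
     + of_nat ((j + 1) * (j + 2)) * a (j + 2) k + of_nat ((j + k + 2) * (k + 1)) * a j (k + 1)"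

lemma rec_coeff_sum:
  "rec_coeff (\<lambda>j k. \<Sum>i\<in>S. c i * a i j k) j k = (\<Sum>i\<in>S. c i * rec_coeff (a i) j k)"
proof -
  have linear: "rec_coeff (\<lambda>j k. d * f j k + g j k) j k = d * rec_coeff f j k + rec_coeff g j k" for d f g
    by (simp add: rec_coeff_def algebra_simps)
  show ?thesis
    by (induction S rule: infinite_finite_induct) (simp_all add: linear, simp_all add: rec_coeff_def)
qed

text \<open>Each of the three \<open>inv_fact\<close> factors takes arguments that differ by at most
  2, so every term is a polynomial multiple of one common factor \<open>c\<close>, built from the
  largest arguments. What remains is a polynomial identity in a, r, j, k, using n = a + r + j;
  nothing is divided by an integer that could be 0.\<close>

lemma gauss_coeff_rec:
  "of_nat (n + 1) * gauss_coeff (n + 1) m j k = rec_coeff (gauss_coeff n m) j k"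
proof -
  define a where "a = int n - m + int k"
  define r where "r = m - int j - int k"
  define q where "q = a + int k + int j + 1"
  define \<alpha> where "\<alpha> = inv_fact (a + 1)"
  define \<rho> where "\<rho> = inv_fact r"
  define \<theta> where "\<theta> = inv_fact (q + 2)"
  define c where "c = (-1) ^ j * fact (n + k + 1) / (fact j * fact k) * \<alpha> * \<rho> * \<theta>"
  have ia: "inv_fact a = of_int (a + 1) * \<alpha>"
    using inv_fact_rec[of "a + 1"] by (simp add: \<alpha>_def)
  have ir: "inv_fact (r - 1) = of_int r * \<rho>" "inv_fact (r - 2) = of_int r * of_int (r - 1) * \<rho>"
    using inv_fact_rec[of "r"] inv_fact_rec[of "r - 1"] by (auto simp: \<rho>_def)
  have iq: "inv_fact (q + 1) = of_int (q + 2) * \<theta>" "inv_fact q = of_int (q + 2) * of_int (q + 1) * \<theta>"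
  proof -
    have "q + 2 - 1 = q + 1" "q + 1 - 1 = q" by simp_all
    then show "inv_fact (q + 1) = of_int (q + 2) * \<theta>"
      using inv_fact_rec[of "q + 2"] by (simp only: \<theta>_def)
    then show "inv_fact q = of_int (q + 2) * of_int (q + 1) * \<theta>"
      using inv_fact_rec[of "q + 1"] by simp
  qed
  have g0: "gauss_coeff n m j k = c * of_int (a + 1) * of_int (q + 2) * of_int (q + 1)"
  proof -
    have e: "int n - m + 2 * int k + int j + 1 = q"
      by (simp add: q_def a_def)
    show ?thesis
      unfolding gauss_coeff_def e a_def[symmetric] r_def[symmetric] \<rho>_def[symmetric] ia iq c_def
      by (simp add: field_simps del: of_nat_Suc)
  qed
  have g1: "of_nat (j + 1) * gauss_coeff n m (j + 1) k = - c * of_int (a + 1) * of_int r * of_int (q + 2)"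
  proof -
    have e: "m - int (j + 1) - int k = r - 1" "int n - m + 2 * int k + int (j + 1) + 1 = q + 1"
      by (auto simp: r_def q_def a_def)
    show ?thesis
      unfolding gauss_coeff_def e a_def[symmetric] ia ir iq c_def by (simp add: field_simps del: of_nat_Suc)
  qed
  have g2: "of_nat ((j + 1) * (j + 2)) * gauss_coeff n m (j + 2) k
      = c * of_int (a + 1) * of_int r * of_int (r - 1)"
  proof -
    have e: "m - int (j + 2) - int k = r - 2" "int n - m + 2 * int k + int (j + 2) + 1 = q + 2"
      by (auto simp: r_def q_def a_def)
    have f: "(fact (j + 2) :: complex) = of_nat ((j + 1) * (j + 2)) * fact j"
      by (simp add: algebra_simps)
    show ?thesis
      unfolding gauss_coeff_def e a_def[symmetric] ia ir iq c_def f \<theta>_def[symmetric]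
      by (simp add: field_simps del: of_nat_Suc of_nat_mult of_nat_add)
  qed
  have g3: "of_nat (k + 1) * gauss_coeff n m j (k + 1) = c * of_nat (n + k + 2) * of_int r"
  proof -
    have e: "m - int j - int (k + 1) = r - 1" "int n - m + 2 * int (k + 1) + int j + 1 = q + 2"
      "int n - m + int (k + 1) = a + 1"
      by (auto simp: r_def q_def a_def)
    show ?thesis
      unfolding gauss_coeff_def e ir iq c_def \<theta>_def[symmetric] \<alpha>_def[symmetric]
      by (simp add: field_simps del: of_nat_Suc of_nat_mult of_nat_add)
  qed
  have g4: "of_nat (k + 1) * gauss_coeff n m (j - 1) (k + 1)
      = - c * of_nat (n + k + 2) * of_int (q + 2) * of_nat j" if "j \<noteq> 0"
  proof -
    from that obtain j' where j': "j = Suc j'" by (cases j) auto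
    have e: "m - int (j - 1) - int (k + 1) = r" "int n - m + 2 * int (k + 1) + int (j - 1) + 1 = q + 1"
      "int n - m + int (k + 1) = a + 1"
      using j' by (auto simp: r_def q_def a_def)
    show ?thesis
      unfolding gauss_coeff_def e ir iq c_def \<rho>_def[symmetric] \<alpha>_def[symmetric]
      using j' by (simp add: field_simps del: of_nat_Suc of_nat_mult of_nat_add)
  qed
  have gn: "gauss_coeff (n + 1) m j k = c * of_nat (n + k + 2) * of_int (q + 2)"
  proof -
    have e: "int (n + 1) - m + 2 * int k + int j + 1 = q + 1"
      "int (n + 1) - m + int k = a + 1"
      by (auto simp: r_def q_def a_def)
    show ?thesis
      unfolding gauss_coeff_def e r_def[symmetric] ir iq c_def \<rho>_def[symmetric] \<alpha>_def[symmetric]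
      by (simp add: field_simps del: of_nat_Suc of_nat_mult of_nat_add)
  qed
  have g4': "(if j = 0 then 0 else of_nat (k + 1) * gauss_coeff n m (j - 1) (k + 1))
      = - c * of_nat (n + k + 2) * of_int (q + 2) * of_nat j"
    using g4 by simp
  have g3': "of_nat ((j + k + 2) * (k + 1)) * gauss_coeff n m j (k + 1)
      = of_nat (j + k + 2) * (c * of_nat (n + k + 2) * of_int r)"
    unfolding g3[symmetric] by (simp only: of_nat_mult mult.assoc)
  have g1': "2 * of_nat (j + 1) * gauss_coeff n m (j + 1) k = 2 * (- c * of_int (a + 1) * of_int r * of_int (q + 2))"
    unfolding g1[symmetric] by (simp only: mult.assoc)
  have q': "of_int q = (of_int a + of_nat k + of_nat j + 1 :: complex)"
    by (simp add: q_def)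
  have n': "of_nat n = (of_int a + of_int r + of_nat j :: complex)"
  proof -
    have "int n = a + r + int j" by (simp add: a_def r_def)
    from arg_cong[OF this, of "of_int :: int \<Rightarrow> complex"] show ?thesis by simp
  qed
  show ?thesis
    unfolding rec_coeff_def g0 g1' g2 g3' g4' gn
    by (simp add: q' n' algebra_simps)
qed

text \<open>For n = 0 the factors 1/(k - m)! and 1/(m - j - k)! force k = m and j = 0. This is the
  initial value p^m divided by m!.\<close>

lemma gauss_coeff_0:
  "gauss_coeff 0 m j k = (if j = 0 \<and> int k = m then 1 / fact k else 0)"
proof -
  have "int k - m \<ge> 0 \<and> m - int j - int k \<ge> 0 \<Longrightarrow> j = 0 \<and> m = int k" by linarith
  moreover have "gauss_coeff 0 m j k = 0" if "\<not> (int k - m \<ge> 0 \<and> m - int j - int k \<ge> 0)"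
    using that by (auto simp: gauss_coeff_def inv_fact_neg)
  moreover have "gauss_coeff 0 (int k) 0 k = 1 / fact k"
  proof -
    have "(1 + of_nat k :: complex) \<noteq> 0"
      by (metis of_nat_Suc of_nat_eq_0_iff nat.distinct(1))
    moreover have "inv_fact (int k + 1) = 1 / ((1 + of_nat k) * fact k)"
      using inv_fact_of_nat[of "k + 1"] by (simp add: add.commute)
    ultimately show ?thesis
      using inv_fact_of_nat[of 0] by (simp add: gauss_coeff_def)
  qed
  ultimately show ?thesis
    by auto
qed

lemma gauss_coeff_eq_0:
  assumes "m < int j + int k"
  shows "gauss_coeff n m j k = 0"
  using assms by (simp add: gauss_coeff_def inv_fact_neg)

text \<open>The coefficient after multiplication by exp(\<beta> z): lowering n and m together keeps
  \<alpha> = n - m. The argument m is an integer because m - i may become negative, where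
  \<open>gauss_coeff\<close> vanishes.\<close>

definition corr_coeff :: "complex \<Rightarrow> nat \<Rightarrow> int \<Rightarrow> nat \<Rightarrow> nat \<Rightarrow> complex" where
  "corr_coeff \<beta> n m j k = (\<Sum>i\<le>n. \<beta> ^ i / fact i * gauss_coeff (n - i) (m - int i) j k)"

text \<open>Split n + 1 = (n + 1 - i) + i in the i-th summand. The first part is the factor in
  \<open>gauss_coeff_rec\<close> and kills i = n + 1; the second cancels against i! and kills i = 0,
  and shifting i produces the \<beta> term.\<close>

lemma corr_coeff_rec:
  "of_nat (n + 1) * corr_coeff \<beta> (n + 1) m j k =
     rec_coeff (corr_coeff \<beta> n m) j k + \<beta> * corr_coeff \<beta> n (m - 1) j k"
proof -
  let ?g = "\<lambda>i. gauss_coeff (n + 1 - i) (m - int i) j k"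
  have "of_nat (n + 1) * corr_coeff \<beta> (n + 1) m j k =
      (\<Sum>i\<le>n+1. \<beta> ^ i / fact i * (of_nat (n + 1 - i) * ?g i)) + (\<Sum>i\<le>n+1. \<beta> ^ i / fact i * (of_nat i * ?g i))"
    unfolding corr_coeff_def sum_distrib_left sum.distrib[symmetric]
    by (rule sum.cong) (auto simp: of_nat_diff algebra_simps add_divide_distrib)
  also have "(\<Sum>i\<le>n+1. \<beta> ^ i / fact i * (of_nat (n + 1 - i) * ?g i)) =
      (\<Sum>i\<le>n. \<beta> ^ i / fact i * (of_nat (n - i + 1) * gauss_coeff (n - i + 1) (m - int i) j k))"
    by (simp add: Suc_diff_le add_diff_eq)
  also have "\<dots> = rec_coeff (corr_coeff \<beta> n m) j k"
    unfolding gauss_coeff_rec corr_coeff_def by (rule rec_coeff_sum[symmetric])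
  also have "(\<Sum>i\<le>n+1. \<beta> ^ i / fact i * (of_nat i * ?g i)) =
      (\<Sum>i\<le>n. \<beta> ^ (i + 1) / fact (i + 1) * (of_nat (i + 1) * ?g (i + 1)))"
    unfolding Suc_eq_plus1[symmetric] sum.atMost_Suc_shift by simp
  also have "\<dots> = \<beta> * corr_coeff \<beta> n (m - 1) j k"
    unfolding corr_coeff_def sum_distrib_left
  proof (rule sum.cong[OF refl])
    fix i
    have "m - int (i + 1) = m - 1 - int i" "n + 1 - (i + 1) = n - i" by simp_all
    moreover have "\<beta> ^ (i + 1) / fact (i + 1) * (of_nat (i + 1) * x) = \<beta> * (\<beta> ^ i / fact i * x)" for x
      by (simp add: field_simps del: of_nat_Suc)
    ultimately show "\<beta> ^ (i + 1) / fact (i + 1) * (of_nat (i + 1) * ?g (i + 1)) =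
        \<beta> * (\<beta> ^ i / fact i * gauss_coeff (n - i) (m - 1 - int i) j k)"
      by (simp only:)
  qed
  finally show ?thesis .
qed

text \<open>Symmetric polynomials in \<open>\<mu>\<close>, \<open>\<nu>\<close> are polynomials in \<open>s = \<mu> + \<nu>\<close> (outer variable) whose
  coefficients are polynomials in \<open>p = \<mu> \<nu>\<close> (inner variable).\<close>
definition eval2 :: "complex poly poly \<Rightarrow> complex \<Rightarrow> complex \<Rightarrow> complex" where
  "eval2 F s p = poly (poly F [:s:]) p"

text \<open>The operator \<open>(1 - \<partial>\<mu>)(1 - \<partial>\<nu>) - (\<partial>\<mu> - \<partial>\<nu>)/(\<mu> - \<nu>)\<close> in the variables \<open>s\<close> and \<open>p\<close>.\<close>
definition rec_op :: "complex poly poly \<Rightarrow> complex poly poly" where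
  "rec_op F = F - Polynomial.smult 2 (pderiv F) - pCons 0 (map_poly pderiv F) + pderiv (pderiv F)
     + pCons 0 (pderiv (map_poly pderiv F)) + Polynomial.smult [:0, 1:] (map_poly pderiv (map_poly pderiv F))
     + Polynomial.smult 2 (map_poly pderiv F)"

text \<open>The factor j + k + 2 in \<open>rec_coeff\<close> collects j from s F_sp, k from p F_pp
  and 2 from 2 F_p.\<close>

lemma coeff_rec_op:
  "coeff (coeff (rec_op F) j) k = rec_coeff (\<lambda>j k. coeff (coeff F j) k) j k"
proof -
  have two: "(2 :: complex poly) = [:2:]"
    by (simp add: numeral_poly)
  have cm: "coeff (map_poly pderiv H) j = pderiv (coeff H j)" for H :: "complex poly poly" and j
    by (simp add: coeff_map_poly)
  have c1: "coeff (coeff (pderiv H) j) k = of_nat (j + 1) * coeff (coeff H (j + 1)) k"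
    for H :: "complex poly poly" and j k
    by (simp add: coeff_pderiv of_nat_poly del: of_nat_Suc)
  have c2: "coeff (coeff (map_poly pderiv H) j) k = of_nat (k + 1) * coeff (coeff H j) (k + 1)"
    for H :: "complex poly poly" and j k
    by (simp add: cm coeff_pderiv del: of_nat_Suc)
  have c3: "coeff (coeff (pCons 0 H) j) k = (if j = 0 then 0 else coeff (coeff H (j - 1)) k)"
    for H :: "complex poly poly" and j k
    by (simp add: coeff_pCons split: nat.split)
  have c4: "coeff (coeff (Polynomial.smult [:0, 1:] H) j) k = (if k = 0 then 0 else coeff (coeff H j) (k - 1))"
    for H :: "complex poly poly" and j k
    by (simp add: coeff_pCons split: nat.split)
  have c5: "coeff (coeff (Polynomial.smult 2 H) j) k = 2 * coeff (coeff H j) k"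
    for H :: "complex poly poly" and j k
    by (simp add: two)
  show ?thesis
    unfolding rec_op_def rec_coeff_def coeff_add coeff_diff c3 c4 c5 c1 c2
    by (cases j; cases k) (simp_all add: algebra_simps)
qed

text \<open>At m = 0 the truncated m - 1 is harmless, since its term carries the factor
  \<open>of_nat m\<close>.\<close>

fun corr_poly :: "complex \<Rightarrow> nat \<Rightarrow> nat \<Rightarrow> complex poly poly" where
  "corr_poly \<beta> 0 m = [:monom 1 m:]"
| "corr_poly \<beta> (Suc n) m = rec_op (corr_poly \<beta> n m) + Polynomial.smult [:\<beta> * of_nat m:] (corr_poly \<beta> n (m - 1))"

lemma coeff_corr_poly:
  "coeff (coeff (corr_poly \<beta> n m) j) k = fact n * fact m * corr_coeff \<beta> n (int m) j k"
proof (induction n arbitrary: m j k)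
  case 0
  show ?case
    by (auto simp: corr_coeff_def gauss_coeff_0 coeff_pCons split: nat.split)
next
  case (Suc n)
  have "coeff (coeff (corr_poly \<beta> (Suc n) m) j) k =
      rec_coeff (\<lambda>j k. fact n * fact m * corr_coeff \<beta> n (int m) j k) j k
      + \<beta> * (of_nat m * (fact n * fact (m - 1) * corr_coeff \<beta> n (int (m - 1)) j k))"
    by (simp add: coeff_rec_op Suc.IH)
  also have "rec_coeff (\<lambda>j k. fact n * fact m * corr_coeff \<beta> n (int m) j k) j k =
      fact n * fact m * rec_coeff (corr_coeff \<beta> n (int m)) j k"
    by (simp add: rec_coeff_def algebra_simps)
  also have "of_nat m * (fact n * fact (m - 1) * corr_coeff \<beta> n (int (m - 1)) j k) =
      fact n * fact m * corr_coeff \<beta> n (int m - 1) j k"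
  proof (cases m)
    \<comment> \<open>Both sides are 0: on the left by the factor m, on the right because the
      integer m - 1 is negative.\<close>
    case 0
    then show ?thesis
      by (simp add: corr_coeff_def gauss_coeff_eq_0)
  next
    case (Suc m')
    then show ?thesis by (simp add: algebra_simps)
  qed
  also have "fact n * fact m * rec_coeff (corr_coeff \<beta> n (int m)) j k +
      \<beta> * (fact n * fact m * corr_coeff \<beta> n (int m - 1) j k) =
      fact n * fact m * (of_nat (n + 1) * corr_coeff \<beta> (n + 1) m j k)"
    unfolding corr_coeff_rec by (simp add: algebra_simps)
  finally show ?case by (simp add: algebra_simps)
qed

section \<open>Evaluation at s and p, and the chain rule\<close>

lemma eval2_simps [simp]:
  "eval2 0 s p = 0"
  "eval2 (F + G) s p = eval2 F s p + eval2 G s p"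
  "eval2 (F - G) s p = eval2 F s p - eval2 G s p"
  "eval2 (Polynomial.smult a F) s p = poly a p * eval2 F s p"
  "eval2 (pCons a F) s p = poly a p + s * eval2 F s p"
  by (simp_all add: eval2_def)

lemma map_poly_pderiv_pCons:
  fixes a :: "complex poly"
  shows "map_poly pderiv (pCons a F) = pCons (pderiv a) (map_poly pderiv F)"
  by (cases "F = 0 \<and> a = 0") (auto simp: map_poly_pCons)

text \<open>The chain rule for F(s, p): \<open>pderiv\<close> is the derivative in the outer
  variable s, \<open>map_poly pderiv\<close> the one in the inner variable p.\<close>

lemma DERIV_eval2:
  assumes "(S has_field_derivative S') (at x)" "(P has_field_derivative P') (at x)"
  shows "((\<lambda>x. eval2 F (S x) (P x)) has_field_derivative
    (S' * eval2 (pderiv F) (S x) (P x) + P' * eval2 (map_poly pderiv F) (S x) (P x))) (at x)"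
proof (induction F rule: pCons_induct)
  case 0
  show ?case by simp
next
  case (pCons a F)
  have "((\<lambda>x. poly a (P x)) has_field_derivative poly (pderiv a) (P x) * P') (at x)"
    using DERIV_chain[OF poly_DERIV assms(2)] by (simp add: o_def)
  note D = DERIV_add[OF this DERIV_mult[OF assms(1) pCons.IH]]
  show ?case
    by (simp add: map_poly_pderiv_pCons pderiv_pCons, rule DERIV_cong[OF D]) (simp add: algebra_simps)
qed

lemma poly_eq_sum_bound:
  fixes p :: "'a::comm_semiring_1 poly"
  assumes "degree p \<le> N"
  shows "poly p x = (\<Sum>k\<le>N. coeff p k * x ^ k)"
  unfolding poly_altdef using assms by (intro sum.mono_neutral_left) (auto simp: coeff_eq_0)

lemma eval2_expand:
  assumes "\<And>j k. coeff (coeff F j) k \<noteq> 0 \<Longrightarrow> j \<le> N \<and> k \<le> N"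
  shows "eval2 F s p = (\<Sum>j\<le>N. \<Sum>k\<le>N. coeff (coeff F j) k * s ^ j * p ^ k)"
proof -
  have "degree F \<le> N"
    by (rule degree_le) (use assms in \<open>auto simp: poly_eq_iff\<close>, metis coeff_0 leD assms)
  then have "poly F [:s:] = (\<Sum>j\<le>N. coeff F j * [:s:] ^ j)"
    by (rule poly_eq_sum_bound)
  moreover have "poly (coeff F j) p = (\<Sum>k\<le>N. coeff (coeff F j) k * p ^ k)" for j
  proof -
    have "degree (coeff F j) \<le> N"
      by (rule degree_le) (use assms in \<open>meson leD\<close>)
    then show ?thesis by (rule poly_eq_sum_bound)
  qed
  ultimately show ?thesis
    by (simp add: eval2_def poly_sum poly_power sum_distrib_left sum_distrib_right ac_simps)
qed

section \<open>The generating function\<close>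

text \<open>A Cauchy product with the geometric series raises the exponent by one, and the
  coefficients add up by the hockey-stick identity \<open>sum_choose_lower\<close>. Absolute
  convergence is a hypothesis because it is immediate for nonnegative reals, and the complex case
  then takes it from the real one.\<close>

lemma binomial_series_step:
  fixes z :: "'a::{real_normed_field, banach}"
  assumes z: "norm z < 1"
    and s: "summable (\<lambda>r. norm (of_nat ((d + r) choose r) * z ^ r))"
    and IH: "(\<lambda>r. of_nat ((d + r) choose r) * z ^ r) sums (1 / (1 - z) ^ Suc d)"
  shows "(\<lambda>r. of_nat ((Suc d + r) choose r) * z ^ r) sums (1 / (1 - z) ^ Suc (Suc d))"
proof -
  have "summable (\<lambda>r. norm (z ^ r))"
    using z by (simp add: norm_power summable_geometric)
  from Cauchy_product_sums[OF s this]
  have prod: "(\<lambda>k. \<Sum>i\<le>k. of_nat ((d + i) choose i) * z ^ i * z ^ (k - i)) sums (1 / (1 - z) ^ Suc d * (1 / (1 - z)))"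
    unfolding sums_unique[OF IH, symmetric] sums_unique[OF geometric_sums[OF z], symmetric] .
  have eq: "(\<Sum>i\<le>k. of_nat ((d + i) choose i) * z ^ i * z ^ (k - i)) = of_nat ((Suc d + k) choose k) * z ^ k" for k
  proof -
    have "(\<Sum>i\<le>k. of_nat ((d + i) choose i) * z ^ i * z ^ (k - i)) = (\<Sum>i\<le>k. of_nat ((d + i) choose i) * z ^ k)"
      by (rule sum.cong) (auto simp: mult.assoc power_add[symmetric])
    also have "\<dots> = of_nat (\<Sum>i\<le>k. (d + i) choose i) * z ^ k"
      by (simp only: of_nat_sum sum_distrib_right)
    finally show ?thesis by (simp only: sum_choose_lower add_Suc)
  qed
  have "1 / (1 - z) ^ Suc (Suc d) = 1 / (1 - z) ^ Suc d * (1 / (1 - z))"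
    by (simp add: mult.commute)
  then show ?thesis
    using prod unfolding eq by (simp only:)
qed

lemma binomial_series_real:
  fixes x :: real
  assumes "0 \<le> x" "x < 1"
  shows "(\<lambda>r. of_nat ((d + r) choose r) * x ^ r) sums (1 / (1 - x) ^ Suc d)"
proof (induction d)
  case 0
  show ?case using geometric_sums[of x] assms by simp
next
  case (Suc d)
  have "summable (\<lambda>r. norm (of_nat ((d + r) choose r) * x ^ r))"
    using sums_summable[OF Suc.IH] assms by (simp add: abs_mult)
  then show ?case
    using assms Suc.IH by (intro binomial_series_step) auto
qed

lemma binomial_series_complex:
  fixes z :: complex
  assumes "norm z < 1"
  shows "(\<lambda>r. of_nat ((d + r) choose r) * z ^ r) sums (1 / (1 - z) ^ Suc d)"
proof (induction d)
  case 0
  show ?case using geometric_sums[of z] assms by simp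
next
  case (Suc d)
  have "summable (\<lambda>r. norm (of_nat ((d + r) choose r) * z ^ r))"
    using sums_summable[OF binomial_series_real[of "norm z" d]] assms by (simp add: norm_mult norm_power)
  then show ?case
    using assms Suc.IH by (intro binomial_series_step) auto
qed

text \<open>Carrying the sum of the norms along with the sum itself lets Fubini be applied one index
  at a time.\<close>

definition abs_has_sum :: "('i \<Rightarrow> complex) \<Rightarrow> complex \<Rightarrow> real \<Rightarrow> bool" where
  "abs_has_sum f S T \<longleftrightarrow> (f has_sum S) UNIV \<and> ((\<lambda>x. norm (f x)) has_sum T) UNIV"

lemma abs_has_sum_cmult:
  "abs_has_sum f S T \<Longrightarrow> abs_has_sum (\<lambda>x. c * f x) (c * S) (norm c * T)"
  by (auto simp: abs_has_sum_def norm_mult intro: has_sum_cmult_right)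

lemma abs_has_sum_sums:
  assumes "f sums S" "(\<lambda>n. norm (f n)) sums T"
  shows "abs_has_sum f S T"
  using norm_summable_imp_has_sum[OF sums_summable[OF assms(2)] assms(1)] sums_nonneg_imp_has_sum[OF assms(2)]
  by (simp add: abs_has_sum_def)

text \<open>Summability of the norms over the product follows from their iterated sum, and then
  justifies the iterated sum of f itself.\<close>

lemma abs_has_sum_Times:
  assumes f: "\<And>x. abs_has_sum (\<lambda>y. f (x, y)) (g x) (G x)"
    and g: "(g has_sum S) UNIV" and G: "(G has_sum T) UNIV"
  shows "abs_has_sum f S T"
proof -
  have fs: "((\<lambda>y. f (x, y)) has_sum g x) UNIV" "((\<lambda>y. norm (f (x, y))) has_sum G x) UNIV" for x
    using f[of x] by (auto simp: abs_has_sum_def)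
  have n: "(\<lambda>q. norm (f q)) summable_on (UNIV \<times> UNIV)"
    by (rule summable_on_SigmaI[OF fs(2)]) (use G in \<open>auto simp: summable_on_def\<close>)
  have "(f has_sum S) (UNIV \<times> UNIV)"
    by (rule has_sum_SigmaI[OF fs(1) g]) (use n in \<open>auto intro: abs_summable_summable\<close>)
  moreover have "((\<lambda>q. norm (f q)) has_sum T) (UNIV \<times> UNIV)"
    by (rule has_sum_SigmaI[OF fs(2) G n])
  ultimately show ?thesis by (simp add: abs_has_sum_def)
qed

lemma abs_has_sum_exp: "abs_has_sum (\<lambda>i. x ^ i / fact i) (exp x) (exp (norm x))"
proof (rule abs_has_sum_sums)
  show "(\<lambda>i. x ^ i / fact i) sums exp x"
    using exp_converges[of x] by (simp add: scaleR_conv_of_real field_simps)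
  show "(\<lambda>i. norm (x ^ i / fact i)) sums exp (norm x)"
    using exp_converges[of "norm x"] by (simp add: norm_divide norm_power field_simps)
qed

lemma abs_has_sum_binomial:
  assumes "norm z < 1"
  shows "abs_has_sum (\<lambda>r. of_nat ((d + r) choose r) * z ^ r) (1 / (1 - z) ^ Suc d) (1 / (1 - norm z) ^ Suc d)"
proof (rule abs_has_sum_sums[OF binomial_series_complex[OF assms]])
  have "norm (of_nat ((d + r) choose r) * z ^ r) = of_nat ((d + r) choose r) * norm z ^ r" for r
    by (simp add: norm_mult norm_power)
  then show "(\<lambda>r. norm (of_nat ((d + r) choose r) * z ^ r)) sums (1 / (1 - norm z) ^ Suc d)"
    using binomial_series_real[of "norm z" d] assms by (simp only: norm_ge_zero)
qed

section \<open>The right-hand side as a fourfold series\<close>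

lemma summable_power_div_fact_fact:
  fixes x :: real
  assumes "0 \<le> x"
  shows "summable (\<lambda>k. x ^ k / (fact (k + \<alpha>) * fact k))"
proof (rule summable_comparison_test')
  show "summable (\<lambda>k. inverse (fact k) * x ^ k)"
    by (rule summable_exp)
  show "norm (x ^ k / (fact (k + \<alpha>) * fact k)) \<le> inverse (fact k) * x ^ k" for k
  proof -
    have "1 * fact k \<le> (fact (k + \<alpha>) * fact k :: real)"
      by (intro mult_right_mono fact_ge_1) simp
    then have "x ^ k / (fact (k + \<alpha>) * fact k) \<le> x ^ k / (1 * fact k)"
      using assms by (intro divide_left_mono) auto
    then show ?thesis
      using assms by (simp add: divide_inverse mult.commute)
  qed
qed

text \<open>The indices k, j, i come from the series in p z and from the exponentials in s and
  \<beta>. The index r expands (1 - z)^-(\<alpha> + j + 2k + 2), whose exponent combines \<alpha> +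
  2k + 2 from the k-th summand with j from (z / (1 - z))^j. The total degree in z is k + j + i +
  r.\<close>

definition gen_term :: "complex \<Rightarrow> complex \<Rightarrow> complex \<Rightarrow> complex \<Rightarrow> nat \<Rightarrow> nat \<times> nat \<times> nat \<times> nat \<Rightarrow> complex" where
  "gen_term \<beta> s p z \<alpha> = (\<lambda>(k, j, i, r). (p * z) ^ k / (fact (k + \<alpha>) * fact k) * ((- s * z) ^ j / fact j *
     ((\<beta> * z) ^ i / fact i * (of_nat ((\<alpha> + j + 2 * k + 1 + r) choose r) * z ^ r))))"

text \<open>Moves j of the inverse powers of W into the argument x, so that summing over j gives
  exp(x / W). It serves W = 1 - z for the sum and W = 1 - |z| for the sum of the norms.\<close>

lemma power_divide_rescale:
  fixes W :: "'a::field"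
  shows "x ^ j / f * (1 / W ^ Suc (\<alpha> + j + 2 * k + 1) * y) = 1 / W ^ (\<alpha> + 2 * k + 2) * (y * ((x / W) ^ j / f))"
proof -
  define V where "V = W ^ (\<alpha> + 2 * k + 2)"
  have "W ^ Suc (\<alpha> + j + 2 * k + 1) = V * W ^ j"
    unfolding V_def power_add[symmetric] by (simp add: ac_simps)
  then show ?thesis
    unfolding V_def[symmetric] by (simp add: power_divide ac_simps)
qed

text \<open>The indices r, i, j, k are summed out in this order. The sums of the norms follow the
  same pattern with 1 - z replaced by \<open>\<rho>\<close> = 1 - |z| and the other parameters by
  their absolute values.\<close>

lemma gen_term_has_sum:
  assumes z: "norm z < 1"
  shows "summable (\<lambda>k. (p * z) ^ k / (fact (k + \<alpha>) * fact k) * (1 / (1 - z) ^ (\<alpha> + 2 * k + 2)))"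
    and "(gen_term \<beta> s p z \<alpha> has_sum (exp (- s * (z / (1 - z)) + \<beta> * z) *
      (\<Sum>k. (p * z) ^ k / (fact (k + \<alpha>) * fact k) * (1 / (1 - z) ^ (\<alpha> + 2 * k + 2))))) UNIV"
proof -
  define \<rho> where "\<rho> = 1 - norm z"
  have \<rho>: "\<rho> > 0" and z1: "1 - z \<noteq> 0" using z by (auto simp: \<rho>_def)
  define A where "A k = (p * z) ^ k / (fact (k + \<alpha>) * fact k)" for k
  define d where "d k j = \<alpha> + j + 2 * k + 1" for k j
  let ?f = "\<lambda>k j i r. A k * ((- s * z) ^ j / fact j * ((\<beta> * z) ^ i / fact i * (of_nat ((d k j + r) choose r) * z ^ r)))"
  have L1: "abs_has_sum (?f k j i)
      (A k * ((- s * z) ^ j / fact j * ((\<beta> * z) ^ i / fact i * (1 / (1 - z) ^ Suc (d k j)))))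
      (norm (A k) * (norm ((- s * z) ^ j / fact j) * (norm ((\<beta> * z) ^ i / fact i) * (1 / \<rho> ^ Suc (d k j)))))" for k j i
    unfolding \<rho>_def by (intro abs_has_sum_cmult abs_has_sum_binomial z)
  have L2: "abs_has_sum (\<lambda>(i, r). ?f k j i r)
      (A k * ((- s * z) ^ j / fact j * (1 / (1 - z) ^ Suc (d k j) * exp (\<beta> * z))))
      (norm (A k) * (norm ((- s * z) ^ j / fact j) * (1 / \<rho> ^ Suc (d k j) * exp (norm (\<beta> * z)))))" for k j
  proof (rule abs_has_sum_Times)
    show "abs_has_sum (\<lambda>r. case (i, r) of (i, r) \<Rightarrow> ?f k j i r)
      (A k * ((- s * z) ^ j / fact j * ((1 / (1 - z) ^ Suc (d k j)) * ((\<beta> * z) ^ i / fact i))))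
      (norm (A k) * (norm ((- s * z) ^ j / fact j) * ((1 / \<rho> ^ Suc (d k j)) * norm ((\<beta> * z) ^ i / fact i))))" for i
      using L1[of k j i] by (simp add: mult.commute)
    show "((\<lambda>i. A k * ((- s * z) ^ j / fact j * ((1 / (1 - z) ^ Suc (d k j)) * ((\<beta> * z) ^ i / fact i)))) has_sum
      (A k * ((- s * z) ^ j / fact j * (1 / (1 - z) ^ Suc (d k j) * exp (\<beta> * z))))) UNIV"
      using abs_has_sum_exp[of "\<beta> * z"] unfolding abs_has_sum_def by (intro has_sum_cmult_right) auto
    show "((\<lambda>i. norm (A k) * (norm ((- s * z) ^ j / fact j) * ((1 / \<rho> ^ Suc (d k j)) * norm ((\<beta> * z) ^ i / fact i)))) has_sum
      (norm (A k) * (norm ((- s * z) ^ j / fact j) * (1 / \<rho> ^ Suc (d k j) * exp (norm (\<beta> * z)))))) UNIV"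
      using abs_has_sum_exp[of "\<beta> * z"] unfolding abs_has_sum_def by (intro has_sum_cmult_right) auto
  qed
  have L3: "abs_has_sum (\<lambda>(j, i, r). ?f k j i r)
      (A k * (1 / (1 - z) ^ (\<alpha> + 2 * k + 2) * (exp (\<beta> * z) * exp (- s * z / (1 - z)))))
      (norm (A k) * (1 / \<rho> ^ (\<alpha> + 2 * k + 2) * (exp (norm (\<beta> * z)) * exp (norm (- s * z) / \<rho>))))" for k
  proof (rule abs_has_sum_Times)
    have e: "(- s * z) ^ j / fact j * (1 / (1 - z) ^ Suc (d k j) * y) =
        1 / (1 - z) ^ (\<alpha> + 2 * k + 2) * (y * ((- s * z / (1 - z)) ^ j / fact j))" for j y
      unfolding d_def by (rule power_divide_rescale)
    have e': "norm ((- s * z) ^ j / fact j) * (1 / \<rho> ^ Suc (d k j) * y) =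
        1 / \<rho> ^ (\<alpha> + 2 * k + 2) * (y * ((norm (- s * z) / \<rho>) ^ j / fact j))" for j y
      unfolding d_def norm_divide norm_power norm_fact by (rule power_divide_rescale)
    show "abs_has_sum (\<lambda>q. case (j, q) of (j, i, r) \<Rightarrow> ?f k j i r)
        (A k * (1 / (1 - z) ^ (\<alpha> + 2 * k + 2) * (exp (\<beta> * z) * ((- s * z / (1 - z)) ^ j / fact j))))
        (norm (A k) * (1 / \<rho> ^ (\<alpha> + 2 * k + 2) * (exp (norm (\<beta> * z)) * ((norm (- s * z) / \<rho>) ^ j / fact j))))" for j
      using L2[of k j] unfolding e e' by simp
    show "((\<lambda>j. A k * (1 / (1 - z) ^ (\<alpha> + 2 * k + 2) * (exp (\<beta> * z) * ((- s * z / (1 - z)) ^ j / fact j)))) has_sum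
        (A k * (1 / (1 - z) ^ (\<alpha> + 2 * k + 2) * (exp (\<beta> * z) * exp (- s * z / (1 - z)))))) UNIV"
      using abs_has_sum_exp[of "- s * z / (1 - z)"] unfolding abs_has_sum_def by (intro has_sum_cmult_right) auto
    have "((\<lambda>j. (norm (- s * z) / \<rho>) ^ j / fact j) has_sum exp (norm (- s * z) / \<rho>)) UNIV"
      using exp_converges[of "norm (- s * z) / \<rho>"] \<rho> by (intro sums_nonneg_imp_has_sum) (auto simp: divide_inverse mult.commute)
    then show "((\<lambda>j. norm (A k) * (1 / \<rho> ^ (\<alpha> + 2 * k + 2) * (exp (norm (\<beta> * z)) * ((norm (- s * z) / \<rho>) ^ j / fact j)))) has_sum
        (norm (A k) * (1 / \<rho> ^ (\<alpha> + 2 * k + 2) * (exp (norm (\<beta> * z)) * exp (norm (- s * z) / \<rho>))))) UNIV"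
      by (intro has_sum_cmult_right)
  qed
  \<comment> \<open>The power of \<open>\<rho>\<close> splits into a constant and k factors of its
    square, so it only rescales the argument of a series that converges everywhere.\<close>
  have "summable (\<lambda>k. (norm (p * z) / \<rho>\<^sup>2) ^ k / (fact (k + \<alpha>) * fact k) * (1 / \<rho> ^ (\<alpha> + 2)))"
    by (intro summable_mult2 summable_power_div_fact_fact) simp
  moreover have "(norm (p * z) / \<rho>\<^sup>2) ^ k / (fact (k + \<alpha>) * fact k) * (1 / \<rho> ^ (\<alpha> + 2)) =
      norm (A k) * (1 / \<rho> ^ (\<alpha> + 2 * k + 2))" for k
    using \<rho> by (simp add: A_def norm_divide norm_mult norm_power power_divide power_mult[symmetric] power_add field_simps)
  ultimately have sG: "summable (\<lambda>k. norm (A k) * (1 / \<rho> ^ (\<alpha> + 2 * k + 2)))"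
    by simp
  have sg: "summable (\<lambda>k. norm (A k * (1 / (1 - z) ^ (\<alpha> + 2 * k + 2))))"
  proof (rule summable_comparison_test'[OF sG])
    fix k
    have "\<rho> \<le> norm (1 - z)"
      using norm_triangle_ineq2[of 1 z] by (simp add: \<rho>_def)
    then have "\<rho> ^ (\<alpha> + 2 * k + 2) \<le> norm (1 - z) ^ (\<alpha> + 2 * k + 2)"
      using \<rho> by (intro power_mono) auto
    then have "1 / norm (1 - z) ^ (\<alpha> + 2 * k + 2) \<le> 1 / \<rho> ^ (\<alpha> + 2 * k + 2)"
      using \<rho> by (intro divide_left_mono mult_pos_pos zero_less_power) (use z1 in auto)
    then have "norm (A k) * (1 / norm (1 - z) ^ (\<alpha> + 2 * k + 2)) \<le> norm (A k) * (1 / \<rho> ^ (\<alpha> + 2 * k + 2))"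
      by (rule mult_left_mono) simp
    then show "norm (norm (A k * (1 / (1 - z) ^ (\<alpha> + 2 * k + 2)))) \<le> norm (A k) * (1 / \<rho> ^ (\<alpha> + 2 * k + 2))"
      by (simp add: norm_mult norm_divide norm_power)
  qed
  show "summable (\<lambda>k. (p * z) ^ k / (fact (k + \<alpha>) * fact k) * (1 / (1 - z) ^ (\<alpha> + 2 * k + 2)))"
    using summable_norm_cancel[OF sg] by (simp add: A_def)
  define X where "X = (\<Sum>k. A k * (1 / (1 - z) ^ (\<alpha> + 2 * k + 2)))"
  have g: "((\<lambda>k. A k * (1 / (1 - z) ^ (\<alpha> + 2 * k + 2))) has_sum X) UNIV"
    using norm_summable_imp_has_sum[OF sg] summable_sums[OF summable_norm_cancel[OF sg]] by (simp add: X_def)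
  have G: "((\<lambda>k. norm (A k) * (1 / \<rho> ^ (\<alpha> + 2 * k + 2))) has_sum (\<Sum>k. norm (A k) * (1 / \<rho> ^ (\<alpha> + 2 * k + 2)))) UNIV"
    using \<rho> by (intro sums_nonneg_imp_has_sum summable_sums[OF sG]) auto
  have "abs_has_sum (\<lambda>(k, j, i, r). ?f k j i r) (X * (exp (\<beta> * z) * exp (- s * z / (1 - z))))
      ((\<Sum>k. norm (A k) * (1 / \<rho> ^ (\<alpha> + 2 * k + 2))) * (exp (norm (\<beta> * z)) * exp (norm (- s * z) / \<rho>)))"
    by (rule abs_has_sum_Times[OF _ has_sum_cmult_left[OF g] has_sum_cmult_left[OF G]])
      (use L3 in \<open>simp add: mult.assoc\<close>)
  moreover have "X * (exp (\<beta> * z) * exp (- s * z / (1 - z))) = exp (- s * (z / (1 - z)) + \<beta> * z) * X"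
    by (simp add: exp_add[symmetric] add.commute)
  moreover have "(\<lambda>(k, j, i, r). ?f k j i r) = gen_term \<beta> s p z \<alpha>"
    by (simp add: gen_term_def A_def d_def)
  ultimately have "abs_has_sum (gen_term \<beta> s p z \<alpha>) (exp (- s * (z / (1 - z)) + \<beta> * z) * X)
      ((\<Sum>k. norm (A k) * (1 / \<rho> ^ (\<alpha> + 2 * k + 2))) * (exp (norm (\<beta> * z)) * exp (norm (- s * z) / \<rho>)))"
    by (simp only:)
  then show "(gen_term \<beta> s p z \<alpha> has_sum (exp (- s * (z / (1 - z)) + \<beta> * z) *
      (\<Sum>k. (p * z) ^ k / (fact (k + \<alpha>) * fact k) * (1 / (1 - z) ^ (\<alpha> + 2 * k + 2))))) UNIV"
    unfolding abs_has_sum_def X_def A_def by (rule conjunct1)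
qed

text \<open>For m = k + j + r and n = m + \<alpha> all arguments of \<open>inv_fact\<close> are
  natural numbers, and n + k + 1 = d + r, so the factorials of d + r, r and d form a binomial
  coefficient.\<close>

lemma gauss_coeff_eq_binomial:
  "gauss_coeff (k + j + r + \<alpha>) (int (k + j + r)) j k =
     (-1) ^ j / (fact (k + \<alpha>) * fact k * fact j) * of_nat ((\<alpha> + j + 2 * k + 1 + r) choose r)"
proof -
  define d where "d = \<alpha> + j + 2 * k + 1"
  have e: "int (k + j + r + \<alpha>) - int (k + j + r) + int k = int (k + \<alpha>)"
    "int (k + j + r) - int j - int k = int r"
    "int (k + j + r + \<alpha>) - int (k + j + r) + 2 * int k + int j + 1 = int d"
    "k + j + r + \<alpha> + k + 1 = d + r"
    by (simp_all add: d_def)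
  have "of_nat ((d + r) choose r) = (fact (d + r) / (fact r * fact d) :: complex)"
    by (subst binomial_fact) simp_all
  then show ?thesis
    unfolding gauss_coeff_def e inv_fact_of_nat d_def[symmetric] by simp
qed

text \<open>The summands of the fourfold series of degree m in z, with r determined by the other
  three indices. Index triples with k + j + i > m drop out because their \<open>gauss_coeff\<close>
  is 0.\<close>

lemma eval2_corr_poly_gen_term:
  "eval2 (corr_poly \<beta> (m + \<alpha>) m) s p / (fact (m + \<alpha>) * fact m) * z ^ m =
     (\<Sum>(k, j, i)\<in>{(k, j, i). k + j + i \<le> m}. gen_term \<beta> s p z \<alpha> (k, j, i, m - k - j - i))"
proof -
  define u where "u k j i = \<beta> ^ i / fact i * gauss_coeff (m + \<alpha> - i) (int m - int i) j k * s ^ j * p ^ k * z ^ m" for k j i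
  have nz: "j \<le> m \<and> k \<le> m" if "coeff (coeff (corr_poly \<beta> (m + \<alpha>) m) j) k \<noteq> 0" for j k
  proof (rule ccontr)
    assume *: "\<not> (j \<le> m \<and> k \<le> m)"
    have "gauss_coeff (m + \<alpha> - i) (int m - int i) j k = 0" for i
      by (rule gauss_coeff_eq_0) (use * in linarith)
    then show False
      using that by (simp add: coeff_corr_poly corr_coeff_def)
  qed
  have "eval2 (corr_poly \<beta> (m + \<alpha>) m) s p / (fact (m + \<alpha>) * fact m) * z ^ m =
      (\<Sum>j\<le>m. \<Sum>k\<le>m. corr_coeff \<beta> (m + \<alpha>) (int m) j k * s ^ j * p ^ k * z ^ m)"
    by (subst eval2_expand[of _ m], rule nz, assumption)
      (simp add: coeff_corr_poly sum_divide_distrib sum_distrib_right mult.assoc)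
  also have "\<dots> = (\<Sum>k\<le>m. \<Sum>j\<le>m. \<Sum>i\<le>m + \<alpha>. u k j i)"
    unfolding corr_coeff_def sum_distrib_right u_def by (rule sum.swap)
  also have "\<dots> = (\<Sum>(k, j, i)\<in>{..m} \<times> {..m} \<times> {..m + \<alpha>}. u k j i)"
    by (simp add: sum.cartesian_product)
  also have "\<dots> = (\<Sum>(k, j, i)\<in>{(k, j, i). k + j + i \<le> m}. u k j i)"
  proof (rule sum.mono_neutral_right)
    show "\<forall>q\<in>{..m} \<times> {..m} \<times> {..m + \<alpha>} - {(k, j, i). k + j + i \<le> m}. (case q of (k, j, i) \<Rightarrow> u k j i) = 0"
    proof
      fix q assume q: "q \<in> {..m} \<times> {..m} \<times> {..m + \<alpha>} - {(k, j, i). k + j + i \<le> m}"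
      obtain k j i where q_eq: "q = (k, j, i)" by (cases q)
      have "gauss_coeff (m + \<alpha> - i) (int m - int i) j k = 0"
        using q by (intro gauss_coeff_eq_0) (auto simp: q_eq)
      then show "(case q of (k, j, i) \<Rightarrow> u k j i) = 0" by (simp add: q_eq u_def)
    qed
  qed auto
  also have "\<dots> = (\<Sum>(k, j, i)\<in>{(k, j, i). k + j + i \<le> m}. gen_term \<beta> s p z \<alpha> (k, j, i, m - k - j - i))"
  proof (rule sum.cong[OF refl], clarify)
    fix k j i assume le: "k + j + i \<le> m"
    define r where "r = m - k - j - i"
    have m: "m = k + j + r + i" using le by (simp add: r_def)
    have e: "m + \<alpha> - i = k + j + r + \<alpha>" "int m - int i = int (k + j + r)"
      by (simp_all add: m)
    have "u k j i = gen_term \<beta> s p z \<alpha> (k, j, i, r)"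
      unfolding u_def e gauss_coeff_eq_binomial gen_term_def
      by (simp add: m power_add power_mult_distrib power_minus[of "s * z"] field_simps power_minus[of s])
    then show "u k j i = gen_term \<beta> s p z \<alpha> (k, j, i, m - k - j - i)" by (simp add: r_def)
  qed
  finally show ?thesis .
qed

text \<open>Absolute summability allows the fourfold series to be regrouped by total degree m; each
  group is finite and equals the m-th summand on the left.\<close>

lemma corr_poly_gen_fun:
  assumes z: "norm z < 1"
  shows "summable (\<lambda>k. (p * z) ^ k / (fact (k + \<alpha>) * fact k) * (1 / (1 - z) ^ (\<alpha> + 2 * k + 2)))"
    and "(\<lambda>m. eval2 (corr_poly \<beta> (m + \<alpha>) m) s p / (fact (m + \<alpha>) * fact m) * z ^ m) sums
     (exp (- s * (z / (1 - z)) + \<beta> * z) *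
      (\<Sum>k. (p * z) ^ k / (fact (k + \<alpha>) * fact k) * (1 / (1 - z) ^ (\<alpha> + 2 * k + 2))))"
    (is "_ sums ?S")
proof -
  show "summable (\<lambda>k. (p * z) ^ k / (fact (k + \<alpha>) * fact k) * (1 / (1 - z) ^ (\<alpha> + 2 * k + 2)))"
    by (rule gen_term_has_sum(1)[OF z])
  let ?B = "\<lambda>m. {(k, j, i). k + j + i \<le> (m::nat)}"
  let ?h = "\<lambda>(m, k, j, i). gen_term \<beta> s p z \<alpha> (k, j, i, m - k - j - i)"
  have fin: "finite (?B m)" for m
    by (rule finite_subset[of _ "{..m} \<times> {..m} \<times> {..m}"]) auto
  have "(gen_term \<beta> s p z \<alpha> has_sum ?S) UNIV \<longleftrightarrow> (?h has_sum ?S) (Sigma UNIV ?B)"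
    by (rule has_sum_reindex_bij_witness[of _ "\<lambda>(m, k, j, i). (k, j, i, m - k - j - i)"
          "\<lambda>(k, j, i, r). (k + j + i + r, k, j, i)"]) auto
  then have "(?h has_sum ?S) (Sigma UNIV ?B)"
    using gen_term_has_sum(2)[OF z] by simp
  then have "((\<lambda>m. \<Sum>(k, j, i)\<in>?B m. gen_term \<beta> s p z \<alpha> (k, j, i, m - k - j - i)) has_sum ?S) UNIV"
    by (rule has_sum_SigmaD) (rule has_sum_finiteI[OF fin], simp add: case_prod_unfold)
  then show "(\<lambda>m. eval2 (corr_poly \<beta> (m + \<alpha>) m) s p / (fact (m + \<alpha>) * fact m) * z ^ m) sums ?S"
    unfolding eval2_corr_poly_gen_term by (rule has_sum_imp_sums)
qed

section \<open>Moments and independence of the entries\<close>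

text \<open>Rows are indexed below N and columns below K. A standard complex Gaussian variable has
  fourth absolute moment 2, so \<beta> measures the deviation from the Gaussian case.\<close>

locale iid_moments = prob_space M for M :: "'w measure" +
  fixes Z :: "nat \<times> nat \<Rightarrow> 'w \<Rightarrow> complex" and N K :: nat and \<beta> :: complex
  assumes indep: "indep_vars (\<lambda>_. borel) Z ({..<N} \<times> {..<K})"
    and fourth: "p \<in> {..<N} \<times> {..<K} \<Longrightarrow> integrable M (\<lambda>w. norm (Z p w) ^ 4)"
    and mean_0: "p \<in> {..<N} \<times> {..<K} \<Longrightarrow> expectation (Z p) = 0"
    and square_0: "p \<in> {..<N} \<times> {..<K} \<Longrightarrow> expectation (\<lambda>w. Z p w ^ 2) = 0"
    and norm_1: "p \<in> {..<N} \<times> {..<K} \<Longrightarrow> expectation (\<lambda>w. Z p w * cnj (Z p w)) = 1"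
    and norm_4: "p \<in> {..<N} \<times> {..<K} \<Longrightarrow> expectation (\<lambda>w. Z p w ^ 2 * cnj (Z p w) ^ 2) = \<beta> + 2"
begin

lemma measurable_entry: "p \<in> {..<N} \<times> {..<K} \<Longrightarrow> Z p \<in> borel_measurable M"
  using indep by (auto simp: indep_vars_def)

definition mom :: "nat \<times> nat \<Rightarrow> nat \<Rightarrow> nat \<Rightarrow> complex" where
  "mom p a b = expectation (\<lambda>w. Z p w ^ a * cnj (Z p w) ^ b)"

lemma measurable_monomial:
  assumes "p \<in> {..<N} \<times> {..<K}"
  shows "(\<lambda>w. Z p w ^ a * cnj (Z p w) ^ b) \<in> borel_measurable M"
  by (rule measurable_compose[OF measurable_entry[OF assms], of "\<lambda>x. x ^ a * cnj x ^ b"])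
    (intro borel_measurable_continuous_onI continuous_intros)

lemma integrable_monomial:
  assumes p: "p \<in> {..<N} \<times> {..<K}" and ab: "a + b \<le> 4"
  shows "integrable M (\<lambda>w. Z p w ^ a * cnj (Z p w) ^ b)"
proof (rule Bochner_Integration.integrable_bound)
  show "integrable M (\<lambda>w. 1 + norm (Z p w) ^ 4)"
    using fourth[OF p] by simp
  have "x ^ (a + b) \<le> 1 + x ^ 4" if "0 \<le> x" for x :: real
  proof (cases "x \<le> 1")
    case True
    then have "x ^ (a + b) \<le> 1" using that by (simp add: power_le_one)
    then show ?thesis using zero_le_power[OF that, of 4] by linarith
  next
    case False
    then have "x ^ (a + b) \<le> x ^ 4" using ab by (intro power_increasing) auto
    then show ?thesis by linarith
  qed
  then show "AE w in M. norm (Z p w ^ a * cnj (Z p w) ^ b) \<le> norm (1 + norm (Z p w) ^ 4)"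
    by (intro AE_I2) (simp add: norm_mult norm_power power_add[symmetric])
qed (rule measurable_monomial[OF p])

lemma expectation_monomial_prod:
  assumes S: "finite S" "S \<subseteq> {..<N} \<times> {..<K}" and ab: "\<And>p. p \<in> S \<Longrightarrow> a p + b p \<le> 4"
  shows "expectation (\<lambda>w. \<Prod>p\<in>S. Z p w ^ a p * cnj (Z p w) ^ b p) = (\<Prod>p\<in>S. mom p (a p) (b p))"
    and "integrable M (\<lambda>w. \<Prod>p\<in>S. Z p w ^ a p * cnj (Z p w) ^ b p)"
proof -
  have ind: "indep_vars (\<lambda>_. borel) (\<lambda>p w. Z p w ^ a p * cnj (Z p w) ^ b p) S"
    by (rule indep_vars_compose2[OF indep_vars_subset[OF indep S(2)], of "\<lambda>p x. x ^ a p * cnj x ^ b p"])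
      (auto intro!: borel_measurable_continuous_onI continuous_intros)
  have int: "integrable M (\<lambda>w. Z p w ^ a p * cnj (Z p w) ^ b p)" if "p \<in> S" for p
    using integrable_monomial S(2) ab that by blast
  show "expectation (\<lambda>w. \<Prod>p\<in>S. Z p w ^ a p * cnj (Z p w) ^ b p) = (\<Prod>p\<in>S. mom p (a p) (b p))"
    unfolding mom_def by (rule indep_vars_lebesgue_integral[OF S(1) ind int])
  show "integrable M (\<lambda>w. \<Prod>p\<in>S. Z p w ^ a p * cnj (Z p w) ^ b p)"
    by (rule indep_vars_integrable[OF S(1) ind int])
qed

lemma mom_simps:
  assumes "p \<in> {..<N} \<times> {..<K}"
  shows "mom p 0 0 = 1" "mom p 1 0 = 0" "mom p 0 1 = 0" "mom p 1 1 = 1"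
    "mom p 2 0 = 0" "mom p 0 2 = 0" "mom p 2 2 = \<beta> + 2"
proof -
  show "mom p 0 1 = 0" "mom p 0 2 = 0"
    using mean_0[OF assms] square_0[OF assms]
    by (simp_all add: mom_def integral_cnj complex_cnj_power[symmetric] del: complex_cnj_power)
qed (use mean_0[OF assms] square_0[OF assms] norm_1[OF assms] norm_4[OF assms] in
  \<open>simp_all add: mom_def prob_space\<close>)

section \<open>Second and fourth moments within one row\<close>

lemma row_moment_2:
  assumes "n < N" "i < K" "j < K"
  shows "integrable M (\<lambda>w. cnj (Z (n, i) w) * Z (n, j) w)"
    and "expectation (\<lambda>w. cnj (Z (n, i) w) * Z (n, j) w) = (if i = j then 1 else 0)"
proof -
  define a :: "nat \<times> nat \<Rightarrow> nat" where "a p = (if p = (n, j) then 1 else 0)" for p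
  define b :: "nat \<times> nat \<Rightarrow> nat" where "b p = (if p = (n, i) then 1 else 0)" for p
  define S where "S = {(n, i), (n, j)}"
  have S: "finite S" "S \<subseteq> {..<N} \<times> {..<K}" and mem: "(n, i) \<in> S" "(n, j) \<in> S"
    using assms by (auto simp: S_def)
  have eq: "(\<Prod>p\<in>S. Z p w ^ a p * cnj (Z p w) ^ b p) = cnj (Z (n, i) w) * Z (n, j) w" for w
    using S(1) mem
    by (simp add: a_def b_def prod.distrib if_distrib[of "\<lambda>k. _ ^ k"] prod.delta mult.commute cong: if_cong)
  have ab: "a p + b p \<le> 4" for p by (simp add: a_def b_def)
  note E = expectation_monomial_prod[of S a b, OF S ab, unfolded eq]
  show "integrable M (\<lambda>w. cnj (Z (n, i) w) * Z (n, j) w)" by (rule E(2))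
  have "(\<Prod>p\<in>S. mom p (a p) (b p)) = (if i = j then 1 else 0)"
    using assms mom_simps[of "(n, i)"] mom_simps[of "(n, j)"]
    by (auto simp: S_def a_def b_def)
  then show "expectation (\<lambda>w. cnj (Z (n, i) w) * Z (n, j) w) = (if i = j then 1 else 0)"
    using E(1) by simp
qed

lemma row_moment_4:
  assumes "n < N" "i < K" "j < K" "k < K" "l < K"
  shows "integrable M (\<lambda>w. cnj (Z (n, i) w) * Z (n, j) w * (cnj (Z (n, k) w) * Z (n, l) w))"
    and "expectation (\<lambda>w. cnj (Z (n, i) w) * Z (n, j) w * (cnj (Z (n, k) w) * Z (n, l) w)) =
      (if i = j \<and> k = l then 1 else 0) + (if i = l \<and> j = k then 1 else 0)
      + (if i = j \<and> j = k \<and> k = l then \<beta> else 0)"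
proof -
  \<comment> \<open>The multiplicities of each entry among the plain and the conjugated factors; a
    product over the set S then covers coinciding indices uniformly.\<close>
  define a :: "nat \<times> nat \<Rightarrow> nat" where
    "a p = (if p = (n, j) then 1 else 0) + (if p = (n, l) then 1 else 0)" for p
  define b :: "nat \<times> nat \<Rightarrow> nat" where
    "b p = (if p = (n, i) then 1 else 0) + (if p = (n, k) then 1 else 0)" for p
  define S where "S = {(n, i), (n, j), (n, k), (n, l)}"
  have S: "finite S" "S \<subseteq> {..<N} \<times> {..<K}" and mem: "(n, i) \<in> S" "(n, j) \<in> S" "(n, k) \<in> S" "(n, l) \<in> S"
    using assms by (auto simp: S_def)
  have eq: "(\<Prod>p\<in>S. Z p w ^ a p * cnj (Z p w) ^ b p) =
      cnj (Z (n, i) w) * Z (n, j) w * (cnj (Z (n, k) w) * Z (n, l) w)" for w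
    using S(1) mem
    by (simp add: a_def b_def prod.distrib power_add if_distrib[of "\<lambda>k. _ ^ k"] prod.delta ac_simps cong: if_cong)
  have ab: "a p + b p \<le> 4" for p by (simp add: a_def b_def)
  note E = expectation_monomial_prod[of S a b, OF S ab, unfolded eq]
  show "integrable M (\<lambda>w. cnj (Z (n, i) w) * Z (n, j) w * (cnj (Z (n, k) w) * Z (n, l) w))" by (rule E(2))
  have mem: "(n, i) \<in> {..<N} \<times> {..<K}" "(n, j) \<in> {..<N} \<times> {..<K}"
      "(n, k) \<in> {..<N} \<times> {..<K}" "(n, l) \<in> {..<N} \<times> {..<K}"
    using assms by auto
  note m = mem[THEN mom_simps(1)] mem[THEN mom_simps(2)] mem[THEN mom_simps(3)] mem[THEN mom_simps(4)]
    mem[THEN mom_simps(5)] mem[THEN mom_simps(6)] mem[THEN mom_simps(7)]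
  \<comment> \<open>Outside the two pairings either some entry occurs alone and contributes its mean
    0, or i = k differs from j = l and the vanishing means of squares appear. If all four indices
    agree, the pairings give 2 and \<beta> completes the value \<beta> + 2.\<close>
  have "(\<Prod>p\<in>S. mom p (a p) (b p)) = (if i = j \<and> k = l then 1 else 0) + (if i = l \<and> j = k then 1 else 0)
      + (if i = j \<and> j = k \<and> k = l then \<beta> else 0)"
    by (cases "i = j"; cases "i = k"; cases "i = l"; cases "j = k"; cases "j = l"; cases "k = l")
      (simp_all add: S_def a_def b_def m prod.insert_if del: One_nat_def)
  then show "expectation (\<lambda>w. cnj (Z (n, i) w) * Z (n, j) w * (cnj (Z (n, k) w) * Z (n, l) w)) =
      (if i = j \<and> k = l then 1 else 0) + (if i = l \<and> j = k then 1 else 0)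
      + (if i = j \<and> j = k \<and> k = l then \<beta> else 0)"
    using E(1) by simp
qed

text \<open>Measurable factorization through the entries indexed by A. In this form independence of
  entries passes to functions of disjoint blocks of entries, such as a new row and the minors formed
  from the earlier rows.\<close>

definition depends_on :: "(nat \<times> nat) set \<Rightarrow> ('w \<Rightarrow> 'b::topological_space) \<Rightarrow> bool" where
  "depends_on A f \<longleftrightarrow> (\<exists>G\<in>borel_measurable (PiM A (\<lambda>_. borel)). \<forall>w. f w = G (\<lambda>p\<in>A. Z p w))"

lemma depends_on_entry: "p \<in> A \<Longrightarrow> depends_on A (Z p)"
  unfolding depends_on_def by (rule bexI[of _ "\<lambda>z. z p"]) auto

lemma depends_on_const: "depends_on A (\<lambda>_. c)"
  unfolding depends_on_def by (rule bexI[of _ "\<lambda>_. c"]) auto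

lemma depends_on_compose:
  assumes "depends_on A f" "h \<in> borel_measurable borel"
  shows "depends_on A (\<lambda>w. h (f w))"
proof -
  obtain G where "G \<in> borel_measurable (PiM A (\<lambda>_. borel))" "\<And>w. f w = G (\<lambda>p\<in>A. Z p w)"
    using assms(1) by (auto simp: depends_on_def)
  then show ?thesis
    unfolding depends_on_def using assms(2)
    by (intro bexI[of _ "\<lambda>z. h (G z)"]) (auto intro: measurable_compose)
qed

lemma depends_on_cnj: "depends_on A f \<Longrightarrow> depends_on A (\<lambda>w. cnj (f w))"
  by (rule depends_on_compose) (auto intro!: borel_measurable_continuous_onI continuous_intros)

lemma depends_on_norm_square:
  fixes f :: "'w \<Rightarrow> complex"
  shows "depends_on A f \<Longrightarrow> depends_on A (\<lambda>w. norm (f w) ^ 2)"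
  by (rule depends_on_compose) auto

lemma
  fixes f g :: "'w \<Rightarrow> complex"
  assumes "depends_on A f" "depends_on A g"
  shows depends_on_add: "depends_on A (\<lambda>w. f w + g w)"
    and depends_on_mult: "depends_on A (\<lambda>w. f w * g w)"
proof -
  obtain F G where "F \<in> borel_measurable (PiM A (\<lambda>_. borel))" "\<And>w. f w = F (\<lambda>p\<in>A. Z p w)"
    "G \<in> borel_measurable (PiM A (\<lambda>_. borel))" "\<And>w. g w = G (\<lambda>p\<in>A. Z p w)"
    using assms by (auto simp: depends_on_def)
  then show "depends_on A (\<lambda>w. f w + g w)" "depends_on A (\<lambda>w. f w * g w)"
    unfolding depends_on_def
    by (intro bexI[of _ "\<lambda>z. F z + G z"] bexI[of _ "\<lambda>z. F z * G z"]; simp)+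
qed

lemma depends_on_sum:
  fixes f :: "'i \<Rightarrow> 'w \<Rightarrow> complex"
  shows "(\<And>i. i \<in> S \<Longrightarrow> depends_on A (f i)) \<Longrightarrow> depends_on A (\<lambda>w. \<Sum>i\<in>S. f i w)"
  by (induction S rule: infinite_finite_induct) (auto intro: depends_on_add depends_on_const)

lemma depends_on_prod:
  fixes f :: "'i \<Rightarrow> 'w \<Rightarrow> complex"
  shows "(\<And>i. i \<in> S \<Longrightarrow> depends_on A (f i)) \<Longrightarrow> depends_on A (\<lambda>w. \<Prod>i\<in>S. f i w)"
  by (induction S rule: infinite_finite_induct) (auto intro: depends_on_mult depends_on_const)

lemma
  fixes f g :: "'w \<Rightarrow> 'b::{real_normed_field, banach, second_countable_topology}"
  assumes f: "depends_on A f" "A \<subseteq> {..<N} \<times> {..<K}" "integrable M f"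
    and g: "depends_on B g" "B \<subseteq> {..<N} \<times> {..<K}" "integrable M g"
    and disj: "A \<inter> B = {}"
  shows integrable_mult_disjoint: "integrable M (\<lambda>w. f w * g w)"
    and expectation_mult_disjoint: "expectation (\<lambda>w. f w * g w) = expectation f * expectation g"
proof -
  obtain F where F: "F \<in> borel_measurable (PiM A (\<lambda>_. borel))" "\<And>w. f w = F (\<lambda>p\<in>A. Z p w)"
    using f(1) by (auto simp: depends_on_def)
  obtain G where G: "G \<in> borel_measurable (PiM B (\<lambda>_. borel))" "\<And>w. g w = G (\<lambda>p\<in>B. Z p w)"
    using g(1) by (auto simp: depends_on_def)
  have "indep_var borel (F \<circ> (\<lambda>w. \<lambda>p\<in>A. Z p w)) borel (G \<circ> (\<lambda>w. \<lambda>p\<in>B. Z p w))"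
    by (rule indep_var_compose[OF indep_var_restrict[OF indep disj f(2) g(2)] F(1) G(1)])
  also have "F \<circ> (\<lambda>w. \<lambda>p\<in>A. Z p w) = f"
    using F(2) by (auto simp: fun_eq_iff)
  also have "G \<circ> (\<lambda>w. \<lambda>p\<in>B. Z p w) = g"
    using G(2) by (auto simp: fun_eq_iff)
  finally have ind: "indep_var borel f borel g" .
  show "integrable M (\<lambda>w. f w * g w)" "expectation (\<lambda>w. f w * g w) = expectation f * expectation g"
    using indep_var_integrable[OF ind f(3) g(3)] indep_var_lebesgue_integral[OF ind f(3) g(3)] by auto
qed

end

text \<open>The class suited to correlations of two determinants: products of two members are
  integrable, and for the row products cnj(v i) v j membership is a fourth moment condition.\<close>

definition square_integrable :: "'w measure \<Rightarrow> ('w \<Rightarrow> complex) \<Rightarrow> bool" where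
  "square_integrable M f \<longleftrightarrow> f \<in> borel_measurable M \<and> integrable M (\<lambda>w. norm (f w) ^ 2)"

lemma square_integrable_add:
  assumes "square_integrable M f" "square_integrable M g"
  shows "square_integrable M (\<lambda>w. f w + g w)"
proof -
  have [measurable]: "f \<in> borel_measurable M" "g \<in> borel_measurable M"
    using assms by (auto simp: square_integrable_def)
  have "norm (x + y) ^ 2 \<le> 2 * norm x ^ 2 + 2 * norm y ^ 2" for x y :: complex
  proof -
    have "norm (x + y) ^ 2 \<le> (norm x + norm y) ^ 2"
      by (intro power_mono norm_triangle_ineq) auto
    also have "\<dots> \<le> 2 * norm x ^ 2 + 2 * norm y ^ 2"
      using sum_squares_bound[of "norm x" "norm y"] by (simp add: power2_sum)
    finally show ?thesis .
  qed
  then have ae: "AE w in M. norm (norm (f w + g w) ^ 2) \<le> norm (2 * norm (f w) ^ 2 + 2 * norm (g w) ^ 2)"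
    by (intro AE_I2) simp
  have int: "integrable M (\<lambda>w. 2 * norm (f w) ^ 2 + 2 * norm (g w) ^ 2)"
    using assms by (simp add: square_integrable_def)
  have "integrable M (\<lambda>w. norm (f w + g w) ^ 2)"
    by (rule Bochner_Integration.integrable_bound[OF int _ ae]) measurable
  then show ?thesis by (simp add: square_integrable_def)
qed

lemma square_integrable_cmult:
  "square_integrable M f \<Longrightarrow> square_integrable M (\<lambda>w. c * f w)"
  by (auto simp: square_integrable_def norm_mult power_mult_distrib)

lemma square_integrable_0: "square_integrable M (\<lambda>_. 0)"
  by (simp add: square_integrable_def)

lemma square_integrable_sum:
  "(\<And>i. i \<in> S \<Longrightarrow> square_integrable M (f i)) \<Longrightarrow> square_integrable M (\<lambda>w. \<Sum>i\<in>S. f i w)"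
  by (induction S rule: infinite_finite_induct) (auto intro: square_integrable_add square_integrable_0)

lemma square_integrable_mult_integrable:
  assumes "square_integrable M f" "square_integrable M g"
  shows "integrable M (\<lambda>w. f w * g w)"
proof -
  have [measurable]: "f \<in> borel_measurable M" "g \<in> borel_measurable M"
    using assms by (auto simp: square_integrable_def)
  have "norm (x * y) \<le> norm x ^ 2 + norm y ^ 2" for x y :: complex
  proof -
    have "0 \<le> norm x * norm y" by simp
    then show ?thesis
      using sum_squares_bound[of "norm x" "norm y"] unfolding norm_mult by linarith
  qed
  then have ae: "AE w in M. norm (f w * g w) \<le> norm (norm (f w) ^ 2 + norm (g w) ^ 2)"
    by (intro AE_I2) simp
  have int: "integrable M (\<lambda>w. norm (f w) ^ 2 + norm (g w) ^ 2)"
    using assms by (simp add: square_integrable_def)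
  show ?thesis
    by (rule Bochner_Integration.integrable_bound[OF int _ ae]) measurable
qed

text \<open>Since p(2t) - 2^(m+1) p(t) has lower degree, the values of p control its coefficients.\<close>
lemma square_integrable_coeffs:
  assumes "\<And>t. square_integrable M (\<lambda>w. \<Sum>k\<le>m. a k w * t ^ k)" "k \<le> m"
  shows "square_integrable M (a k)"
  using assms
proof (induction m arbitrary: a k)
  case 0
  then show ?case using 0(1)[of 1] by simp
next
  case (Suc m)
  define c :: complex where "c = 2 ^ Suc m"
  have low: "square_integrable M (a k)" if "k \<le> m" for k
  proof -
    have "square_integrable M (\<lambda>w. \<Sum>k\<le>m. ((2 ^ k - c) * a k w) * t ^ k)" for t
    proof -
      have "(\<Sum>k\<le>Suc m. a k w * (2 * t) ^ k) + (- c) * (\<Sum>k\<le>Suc m. a k w * t ^ k) =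
          (\<Sum>k\<le>Suc m. (2 ^ k - c) * a k w * t ^ k)" for w
        unfolding sum_distrib_left sum.distrib[symmetric]
        by (rule sum.cong) (simp_all add: power_mult_distrib algebra_simps)
      then have eq: "(\<lambda>w. (\<Sum>k\<le>Suc m. a k w * (2 * t) ^ k) + (- c) * (\<Sum>k\<le>Suc m. a k w * t ^ k)) =
          (\<lambda>w. \<Sum>k\<le>m. ((2 ^ k - c) * a k w) * t ^ k)"
        by (simp add: c_def)
      have "square_integrable M (\<lambda>w. (\<Sum>k\<le>Suc m. a k w * (2 * t) ^ k) + (- c) * (\<Sum>k\<le>Suc m. a k w * t ^ k))"
        by (rule square_integrable_add[OF Suc.prems(1) square_integrable_cmult[OF Suc.prems(1)]])
      then show ?thesis unfolding eq .
    qed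
    from square_integrable_cmult[OF Suc.IH[OF this that], of "inverse (2 ^ k - c)"]
    have "square_integrable M (\<lambda>w. inverse (2 ^ k - c) * ((2 ^ k - c) * a k w))" .
    moreover have "2 ^ k - c \<noteq> 0"
    proof -
      have "(2::nat) ^ k \<noteq> 2 ^ Suc m" using that by (subst power_inject_exp) auto
      then have "of_nat (2 ^ k) \<noteq> (of_nat (2 ^ Suc m) :: complex)" by (simp only: of_nat_eq_iff not_False_eq_True)
      then show ?thesis by (simp add: c_def)
    qed
    ultimately show ?thesis by (simp add: mult.assoc[symmetric])
  qed
  show ?case
  proof (cases "k \<le> m")
    case False
    then have k: "k = Suc m" using Suc.prems(2) by simp
    have "square_integrable M (\<lambda>w. (\<Sum>k\<le>Suc m. a k w * 1 ^ k) + (- 1) * (\<Sum>k\<le>m. a k w))"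
      by (intro square_integrable_add square_integrable_cmult Suc.prems(1) square_integrable_sum low) simp
    then show ?thesis by (simp add: k)
  qed (rule low)
qed

section \<open>Gram matrices\<close>

text \<open>The constant part \<open>C\<close> and the separate row and column selections \<open>r\<close>, \<open>c\<close> make the family
  closed under taking minors, including the off-diagonal ones.\<close>
definition gram ::
  "nat \<Rightarrow> nat \<Rightarrow> (nat \<Rightarrow> nat \<Rightarrow> complex) \<Rightarrow> (nat \<Rightarrow> nat) \<Rightarrow> (nat \<Rightarrow> nat) \<Rightarrow> (nat \<times> nat \<Rightarrow> complex) \<Rightarrow> complex mat"
where
  "gram n m C r c z = Matrix.mat m m (\<lambda>(j, k). C j k + (\<Sum>i<n. cnj (z (i, r j)) * z (i, c k)))"

lemma gram_carrier [simp]: "gram n m C r c z \<in> carrier_mat m m"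
  by (simp add: gram_def)

lemma gram_dim [simp]: "dim_row (gram n m C r c z) = m" "dim_col (gram n m C r c z) = m"
  by (simp_all add: gram_def)

lemma gram_index:
  "j < m \<Longrightarrow> k < m \<Longrightarrow> gram n m C r c z $$ (j, k) = C j k + (\<Sum>i<n. cnj (z (i, r j)) * z (i, c k))"
  by (simp add: gram_def)

lemma mat_delete_gram:
  "mat_delete (gram n m C r c z) i j =
     gram n (m - 1) (\<lambda>a b. C (insert_index i a) (insert_index j b)) (r \<circ> insert_index i) (c \<circ> insert_index j) z"
  by (rule eq_matI) (auto simp: mat_delete_def gram_def insert_index_def)

lemma cofactor_gram:
  "cofactor (gram n m C r c z) i j = (-1) ^ (i + j) * Determinant.det
     (gram n (m - 1) (\<lambda>a b. C (insert_index i a) (insert_index j b)) (r \<circ> insert_index i) (c \<circ> insert_index j) z)"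
  by (simp add: cofactor_def mat_delete_gram)

lemma det_gram_Suc:
  "Determinant.det (gram (Suc n) m C r c z) = Determinant.det (gram n m C r c z) +
     (\<Sum>i<m. \<Sum>j<m. cnj (z (n, r i)) * z (n, c j) * cofactor (gram n m C r c z) i j)"
proof -
  have "gram (Suc n) m C r c z = Matrix.mat m m (\<lambda>(i, j). gram n m C r c z $$ (i, j) + cnj (z (n, r i)) * z (n, c j))"
    by (rule eq_matI) (auto simp: gram_def)
  then show ?thesis
    by (simp add: det_rank_one_update)
qed

lemma insert_index_less: "i < m - 1 \<Longrightarrow> insert_index k i < m"
  by (auto simp: insert_index_def)

section \<open>Scalar shifts and characteristic polynomials\<close>

definition scalar_entries :: "complex \<Rightarrow> nat \<Rightarrow> nat \<Rightarrow> complex" where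
  "scalar_entries \<mu> j k = (if j = k then - \<mu> else 0)"

lemma scalar_entries_insert_index:
  "(\<lambda>a b. scalar_entries \<mu> (insert_index i a) (insert_index i b)) = scalar_entries \<mu>"
  by (simp add: scalar_entries_def inj_eq[OF insert_index_inj_on] fun_eq_iff)

lemma det_gram_scalar:
  "Determinant.det (gram n m (scalar_entries \<mu>) c c z) =
     (-1) ^ m * poly (char_poly (gram n m (\<lambda>_ _. 0) c c z)) \<mu>"
proof -
  let ?S = "gram n m (\<lambda>_ _. 0) c c z"
  have "- char_matrix ?S \<mu> = (-1) \<cdot>\<^sub>m gram n m (scalar_entries \<mu>) c c z"
    by (rule eq_matI) (auto simp: char_matrix_def gram_def scalar_entries_def)
  then have "poly (char_poly ?S) \<mu> = (-1) ^ m * Determinant.det (gram n m (scalar_entries \<mu>) c c z)"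
    using char_poly_matrix[OF gram_carrier, of n m "\<lambda>_ _. 0" c c z \<mu>] by (simp only: det_smult gram_dim)
  moreover have "(-1 :: complex) ^ m * ((-1) ^ m * x) = x" for x
    by (simp add: minus_one_power_iff)
  ultimately show ?thesis by simp
qed

text \<open>Diagonal minors of S - \<mu> are again of this shape, and the characteristic polynomials
  of the principal minors add up to the derivative of \<open>char_poly\<close>. The size m - 1 of
  the minors causes the minus sign.\<close>

lemma sum_cofactor_gram_scalar:
  "(\<Sum>i<m. cofactor (gram n m (scalar_entries \<mu>) c c z) i i) =
     - ((-1) ^ m * poly (pderiv (char_poly (gram n m (\<lambda>_ _. 0) c c z))) \<mu>)"
proof (cases m)
  case 0
  have "degree (char_poly (gram n 0 (\<lambda>_ _. 0) c c z)) = 0"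
    using degree_monic_char_poly[of "gram n 0 (\<lambda>_ _. 0) c c z" 0] by simp
  then show ?thesis
    using 0 by (simp add: pderiv_eq_0_iff[THEN iffD2])
next
  case (Suc m')
  have "(\<Sum>i<m. cofactor (gram n m (scalar_entries \<mu>) c c z) i i) =
      (\<Sum>i<m. (-1) ^ m' * poly (char_poly (mat_delete (gram n m (\<lambda>_ _. 0) c c z) i i)) \<mu>)"
    unfolding cofactor_gram scalar_entries_insert_index det_gram_scalar mat_delete_gram
    by (simp add: Suc minus_one_power_iff[of "_ + _"])
  also have "\<dots> = (-1) ^ m' * poly (pderiv (char_poly (gram n m (\<lambda>_ _. 0) c c z))) \<mu>"
    by (simp add: pderiv_char_poly[of _ m] poly_sum sum_distrib_left)
  finally show ?thesis
    by (simp add: Suc)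
qed

context iid_moments
begin

lemma depends_on_det_gram:
  assumes "r ` {..<m} \<subseteq> {..<K}" "c ` {..<m} \<subseteq> {..<K}"
  shows "depends_on ({..<n} \<times> {..<K}) (\<lambda>w. Determinant.det (gram n m C r c (\<lambda>p. Z p w)))"
  unfolding det_def'[OF gram_carrier]
proof (intro depends_on_sum depends_on_mult depends_on_const depends_on_prod)
  fix p i assume p: "p \<in> {p. p permutes {0..<m}}" and i: "i \<in> {0..<m}"
  then have pi: "p i < m"
    using permutes_in_image[of p "{0..<m}" i] by simp
  have "depends_on ({..<n} \<times> {..<K}) (\<lambda>w. C i (p i) + (\<Sum>k<n. cnj (Z (k, r i) w) * Z (k, c (p i)) w))"
    using assms i pi
    by (intro depends_on_sum depends_on_add depends_on_mult depends_on_const depends_on_cnj depends_on_entry) auto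
  then show "depends_on ({..<n} \<times> {..<K}) (\<lambda>w. gram n m C r c (\<lambda>p. Z p w) $$ (i, p i))"
    using i pi by (simp add: gram_index)
qed

lemma square_integrable_mult_disjoint:
  assumes f: "depends_on A f" "A \<subseteq> {..<N} \<times> {..<K}" "square_integrable M f"
    and g: "depends_on B g" "B \<subseteq> {..<N} \<times> {..<K}" "square_integrable M g"
    and disj: "A \<inter> B = {}"
  shows "square_integrable M (\<lambda>w. f w * g w)"
proof -
  have "integrable M (\<lambda>w. norm (f w) ^ 2 * norm (g w) ^ 2)"
    using f(3) g(3)
    by (intro integrable_mult_disjoint[OF depends_on_norm_square[OF f(1)] f(2) _ depends_on_norm_square[OF g(1)] g(2) _ disj])
      (auto simp: square_integrable_def)
  then show ?thesis
    using f(3) g(3) by (auto simp: square_integrable_def norm_mult power_mult_distrib)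
qed

text \<open>The squared norm is the norm of the fourth order product in which i and j are swapped in
  the second pair.\<close>

lemma square_integrable_row:
  assumes "n < N" "i < K" "j < K"
  shows "square_integrable M (\<lambda>w. cnj (Z (n, i) w) * Z (n, j) w)"
proof -
  have "integrable M (\<lambda>w. norm (cnj (Z (n, i) w) * Z (n, j) w * (cnj (Z (n, j) w) * Z (n, i) w)))"
    by (rule integrable_norm) (rule row_moment_4(1)[OF assms assms(3,2)])
  moreover have "norm (cnj (Z (n, i) w) * Z (n, j) w * (cnj (Z (n, j) w) * Z (n, i) w)) =
      norm (cnj (Z (n, i) w) * Z (n, j) w) ^ 2" for w
    by (simp add: norm_mult power2_eq_square)
  ultimately show ?thesis
    unfolding square_integrable_def
    using borel_measurable_integrable[OF row_moment_2(1)[OF assms]] by simp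
qed

text \<open>Each row is added by a sum of products of a row factor and a cofactor. The cofactor
  involves only earlier rows, so independence lets square integrability pass to the product. The
  induction covers all C, r, c because the cofactors are general minors.\<close>

lemma square_integrable_det_gram:
  assumes "n \<le> N" "r ` {..<m} \<subseteq> {..<K}" "c ` {..<m} \<subseteq> {..<K}"
  shows "square_integrable M (\<lambda>w. Determinant.det (gram n m C r c (\<lambda>p. Z p w)))"
  using assms
proof (induction n arbitrary: m C r c)
  case 0
  have eq: "gram 0 m C r c z = gram 0 m C r c (\<lambda>_. 0)" for z
    by (simp add: gram_def)
  show ?case
    unfolding eq[of "\<lambda>p. Z p _"] by (simp add: square_integrable_def)
next
  case (Suc n)
  have cof: "square_integrable M (\<lambda>w. cofactor (gram n m C r c (\<lambda>p. Z p w)) i j)" for i j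
    unfolding cofactor_gram using Suc.prems
    by (intro square_integrable_cmult Suc.IH) (auto simp: image_subset_iff insert_index_less)
  have dep: "depends_on ({..<n} \<times> {..<K}) (\<lambda>w. cofactor (gram n m C r c (\<lambda>p. Z p w)) i j)" for i j
    unfolding cofactor_gram using Suc.prems
    by (intro depends_on_mult depends_on_const depends_on_det_gram) (auto simp: image_subset_iff insert_index_less)
  have "square_integrable M (\<lambda>w. cnj (Z (n, r i) w) * Z (n, c j) w * cofactor (gram n m C r c (\<lambda>p. Z p w)) i j)"
    if "i < m" "j < m" for i j
    using Suc.prems that
    by (intro square_integrable_mult_disjoint[OF _ _ _ dep _ cof, of "{n} \<times> {..<K}"] square_integrable_row
        depends_on_mult depends_on_cnj depends_on_entry) auto
  then show ?case
    unfolding det_gram_Suc using Suc.prems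
    by (intro square_integrable_add square_integrable_sum Suc.IH) auto
qed

end

section \<open>Averages of characteristic polynomials\<close>

lemma
  fixes f :: "'i \<Rightarrow> 'j \<Rightarrow> 'w \<Rightarrow> complex"
  assumes "\<And>i j. i \<in> I \<Longrightarrow> j \<in> J \<Longrightarrow> integrable M (f i j)"
  shows integrable_sum2: "integrable M (\<lambda>w. \<Sum>i\<in>I. \<Sum>j\<in>J. f i j w)"
    and integral_sum2: "integral\<^sup>L M (\<lambda>w. \<Sum>i\<in>I. \<Sum>j\<in>J. f i j w) = (\<Sum>i\<in>I. \<Sum>j\<in>J. integral\<^sup>L M (f i j))"
proof -
  have row: "integrable M (\<lambda>w. \<Sum>j\<in>J. f i j w)" if "i \<in> I" for i
    using assms that by (intro Bochner_Integration.integrable_sum) auto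
  show "integrable M (\<lambda>w. \<Sum>i\<in>I. \<Sum>j\<in>J. f i j w)"
    by (rule Bochner_Integration.integrable_sum) (rule row)
  have "integral\<^sup>L M (\<lambda>w. \<Sum>i\<in>I. \<Sum>j\<in>J. f i j w) = (\<Sum>i\<in>I. integral\<^sup>L M (\<lambda>w. \<Sum>j\<in>J. f i j w))"
    by (rule Bochner_Integration.integral_sum) (rule row)
  also have "\<dots> = (\<Sum>i\<in>I. \<Sum>j\<in>J. integral\<^sup>L M (f i j))"
    using assms by (intro sum.cong refl Bochner_Integration.integral_sum) auto
  finally show "integral\<^sup>L M (\<lambda>w. \<Sum>i\<in>I. \<Sum>j\<in>J. f i j w) = (\<Sum>i\<in>I. \<Sum>j\<in>J. integral\<^sup>L M (f i j))" .
qed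

text \<open>The coefficients of p stay unshifted, so a polynomial and its derivative differ only in
  the weights attached to the same coefficients, as \<open>expectation_coeff_chi\<close>
  requires.\<close>

lemma poly_pderiv_eq_sum_bound:
  fixes p :: "complex poly"
  assumes "degree p \<le> N"
  shows "poly (pderiv p) x = (\<Sum>k\<le>N. coeff p k * (of_nat k * x ^ (k - 1)))"
proof (rule DERIV_unique)
  show "((\<lambda>x. poly p x) has_field_derivative poly (pderiv p) x) (at x)"
    by (rule poly_DERIV)
  have "((\<lambda>x. \<Sum>k\<le>N. coeff p k * x ^ k) has_field_derivative (\<Sum>k\<le>N. coeff p k * (of_nat k * x ^ (k - 1)))) (at x)"
    by (rule DERIV_sum) (auto intro!: derivative_eq_intros)
  then show "((\<lambda>x. poly p x) has_field_derivative (\<Sum>k\<le>N. coeff p k * (of_nat k * x ^ (k - 1)))) (at x)"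
    by (simp add: poly_eq_sum_bound[OF assms])
qed

lemma sum_pairings:
  fixes y :: "nat \<Rightarrow> nat \<Rightarrow> nat \<Rightarrow> nat \<Rightarrow> complex"
  shows "(\<Sum>i<m. \<Sum>j<m. \<Sum>k<m. \<Sum>l<m. ((if i = j \<and> k = l then 1 else 0) + (if i = l \<and> j = k then 1 else 0)
      + (if i = j \<and> j = k \<and> k = l then \<beta> else 0)) * y i j k l) =
    (\<Sum>i<m. \<Sum>k<m. y i i k k) + (\<Sum>i<m. \<Sum>j<m. y i j j i) + \<beta> * (\<Sum>i<m. y i i i i)"
proof -
  have if_sum: "(\<Sum>k\<in>S. if b then f k else 0) = (if b then sum f S else 0)" for b and f :: "nat \<Rightarrow> complex" and S
    by simp
  have "((if i = j \<and> k = l then 1 else 0) + (if i = l \<and> j = k then 1 else 0)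
      + (if i = j \<and> j = k \<and> k = l then \<beta> else 0)) * y i j k l =
      (if j = i then if l = k then y i j k l else 0 else 0) + (if k = j then if l = i then y i j k l else 0 else 0)
      + (if j = i then if k = j then if l = k then \<beta> * y i j k l else 0 else 0 else 0)" for i j k l
    by (auto simp: algebra_simps)
  then show ?thesis
    by (simp add: sum.distrib if_sum sum.delta sum_distrib_left)
qed

context iid_moments
begin

definition chi :: "nat \<Rightarrow> nat \<Rightarrow> (nat \<Rightarrow> nat) \<Rightarrow> 'w \<Rightarrow> complex poly" where
  "chi n m c w = char_poly (gram n m (\<lambda>_ _. 0) c c (\<lambda>p. Z p w))"

text \<open>The selection c of columns is a parameter because the \<beta> term of the recursion
  deletes a column.\<close>

definition corr :: "nat \<Rightarrow> nat \<Rightarrow> (nat \<Rightarrow> nat) \<Rightarrow> complex \<Rightarrow> complex \<Rightarrow> complex" where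
  "corr n m c \<mu> \<nu> = expectation (\<lambda>w. Determinant.det (gram n m (scalar_entries \<mu>) c c (\<lambda>p. Z p w))
     * Determinant.det (gram n m (scalar_entries \<nu>) c c (\<lambda>p. Z p w)))"

lemma sign_cancel: "(-1 :: complex) ^ m * x * ((-1) ^ m * y) = x * y"
  by (simp add: minus_one_power_iff)

lemma corr_eq_chi: "corr n m c \<mu> \<nu> = expectation (\<lambda>w. poly (chi n m c w) \<mu> * poly (chi n m c w) \<nu>)"
  unfolding corr_def det_gram_scalar chi_def sign_cancel ..

lemma degree_chi: "degree (chi n m c w) = m"
  using degree_monic_char_poly[OF gram_carrier] by (simp add: chi_def)

lemma square_integrable_coeff_chi:
  assumes "n \<le> N" "c ` {..<m} \<subseteq> {..<K}" "k \<le> m"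
  shows "square_integrable M (\<lambda>w. coeff (chi n m c w) k)"
proof (rule square_integrable_coeffs[OF _ assms(3)])
  fix t
  have "square_integrable M (\<lambda>w. (-1) ^ m * Determinant.det (gram n m (scalar_entries t) c c (\<lambda>p. Z p w)))"
    by (intro square_integrable_cmult square_integrable_det_gram assms)
  moreover have "(-1) ^ m * Determinant.det (gram n m (scalar_entries t) c c (\<lambda>p. Z p w)) =
      (\<Sum>k\<le>m. coeff (chi n m c w) k * t ^ k)" for w
    unfolding det_gram_scalar chi_def[symmetric]
    by (subst poly_eq_sum_bound[of _ m]) (simp_all add: degree_chi minus_one_power_iff)
  ultimately show "square_integrable M (\<lambda>w. \<Sum>k\<le>m. coeff (chi n m c w) k * t ^ k)"
    by simp
qed

text \<open>All averages needed are bilinear in the coefficients of \<open>chi\<close>, so they are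
  governed by one finite array of mixed moments. Arbitrary weights u and v cover both values and
  derivatives.\<close>

lemma expectation_coeff_chi:
  assumes "n \<le> N" "c ` {..<m} \<subseteq> {..<K}"
  shows "expectation (\<lambda>w. (\<Sum>k\<le>m. coeff (chi n m c w) k * u k) * (\<Sum>l\<le>m. coeff (chi n m c w) l * v l)) =
      (\<Sum>k\<le>m. \<Sum>l\<le>m. expectation (\<lambda>w. coeff (chi n m c w) k * coeff (chi n m c w) l) * u k * v l)"
proof -
  have int: "integrable M (\<lambda>w. coeff (chi n m c w) k * coeff (chi n m c w) l * (u k * v l))"
    if "k \<in> {..m}" "l \<in> {..m}" for k l
    using assms that
    by (intro integrable_mult_left square_integrable_mult_integrable square_integrable_coeff_chi) auto
  have eq: "(\<Sum>k\<le>m. coeff (chi n m c w) k * u k) * (\<Sum>l\<le>m. coeff (chi n m c w) l * v l) =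
      (\<Sum>k\<le>m. \<Sum>l\<le>m. coeff (chi n m c w) k * coeff (chi n m c w) l * (u k * v l))" for w
    by (simp add: sum_product ac_simps)
  have "expectation (\<lambda>w. (\<Sum>k\<le>m. coeff (chi n m c w) k * u k) * (\<Sum>l\<le>m. coeff (chi n m c w) l * v l)) =
      (\<Sum>k\<le>m. \<Sum>l\<le>m. expectation (\<lambda>w. coeff (chi n m c w) k * coeff (chi n m c w) l * (u k * v l)))"
    unfolding eq by (rule integral_sum2) (rule int)
  then show ?thesis
    by (simp only: integral_mult_left_zero mult.assoc[of _ "u _" "v _"])
qed

text \<open>No differentiation under the expectation is involved: the average is a polynomial in
  \<mu> and \<nu>, its derivative is taken termwise on one side and by the chain rule through F on
  the other, and the two agree by uniqueness.\<close>

lemma expectation_chi_pderiv: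
  assumes n: "n \<le> N" "c ` {..<m} \<subseteq> {..<K}"
    and F: "\<And>\<mu> \<nu>. corr n m c \<mu> \<nu> = eval2 F (\<mu> + \<nu>) (\<mu> * \<nu>)"
  defines "ds \<equiv> pderiv" and "dp \<equiv> map_poly pderiv"
  shows "expectation (\<lambda>w. poly (chi n m c w) \<mu> * poly (pderiv (chi n m c w)) \<nu>) =
      eval2 (ds F) (\<mu> + \<nu>) (\<mu> * \<nu>) + \<mu> * eval2 (dp F) (\<mu> + \<nu>) (\<mu> * \<nu>)" (is ?A)
    and "expectation (\<lambda>w. poly (pderiv (chi n m c w)) \<mu> * poly (chi n m c w) \<nu>) =
      eval2 (ds F) (\<mu> + \<nu>) (\<mu> * \<nu>) + \<nu> * eval2 (dp F) (\<mu> + \<nu>) (\<mu> * \<nu>)" (is ?B)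
    and "expectation (\<lambda>w. poly (pderiv (chi n m c w)) \<mu> * poly (pderiv (chi n m c w)) \<nu>) =
      eval2 (ds (ds F)) (\<mu> + \<nu>) (\<mu> * \<nu>) + (\<mu> + \<nu>) * eval2 (ds (dp F)) (\<mu> + \<nu>) (\<mu> * \<nu>)
      + \<mu> * \<nu> * eval2 (dp (dp F)) (\<mu> + \<nu>) (\<mu> * \<nu>) + eval2 (dp F) (\<mu> + \<nu>) (\<mu> * \<nu>)" (is ?C)
proof -
  define H where "H k l = expectation (\<lambda>w. coeff (chi n m c w) k * coeff (chi n m c w) l)" for k l
  have p0: "poly (chi n m c w) x = (\<Sum>k\<le>m. coeff (chi n m c w) k * x ^ k)" for w x
    by (rule poly_eq_sum_bound) (simp add: degree_chi)
  have p1: "poly (pderiv (chi n m c w)) x = (\<Sum>k\<le>m. coeff (chi n m c w) k * (of_nat k * x ^ (k - 1)))" for w x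
    by (rule poly_pderiv_eq_sum_bound) (simp add: degree_chi)
  note E = expectation_coeff_chi[OF n, folded H_def]
  have f: "(\<Sum>k\<le>m. \<Sum>l\<le>m. H k l * \<mu> ^ k * \<nu> ^ l) = eval2 F (\<mu> + \<nu>) (\<mu> * \<nu>)" for \<mu> \<nu>
    unfolding F[symmetric] corr_eq_chi p0 E ..
  have A: "(\<Sum>k\<le>m. \<Sum>l\<le>m. H k l * \<mu> ^ k * (of_nat l * \<nu> ^ (l - 1))) =
      eval2 (ds F) (\<mu> + \<nu>) (\<mu> * \<nu>) + \<mu> * eval2 (dp F) (\<mu> + \<nu>) (\<mu> * \<nu>)" for \<mu> \<nu>
  proof (rule DERIV_unique)
    show "((\<lambda>\<nu>. \<Sum>k\<le>m. \<Sum>l\<le>m. H k l * \<mu> ^ k * \<nu> ^ l) has_field_derivative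
        (\<Sum>k\<le>m. \<Sum>l\<le>m. H k l * \<mu> ^ k * (of_nat l * \<nu> ^ (l - 1)))) (at \<nu>)"
      by (intro DERIV_sum) (auto intro!: derivative_eq_intros)
    have "((\<lambda>\<nu>. \<mu> + \<nu>) has_field_derivative 1) (at \<nu>)" "((\<lambda>\<nu>. \<mu> * \<nu>) has_field_derivative \<mu>) (at \<nu>)"
      by (auto intro!: derivative_eq_intros)
    from DERIV_eval2[OF this, of F]
    show "((\<lambda>\<nu>. \<Sum>k\<le>m. \<Sum>l\<le>m. H k l * \<mu> ^ k * \<nu> ^ l) has_field_derivative
        (eval2 (ds F) (\<mu> + \<nu>) (\<mu> * \<nu>) + \<mu> * eval2 (dp F) (\<mu> + \<nu>) (\<mu> * \<nu>))) (at \<nu>)"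
      unfolding f ds_def dp_def by simp
  qed
  have dmu: "((\<lambda>\<mu>. \<mu> + \<nu>) has_field_derivative 1) (at \<mu>)" "((\<lambda>\<mu>. \<mu> * \<nu>) has_field_derivative \<nu>) (at \<mu>)" for \<mu> \<nu> :: complex
    by (auto intro!: derivative_eq_intros)
  have B: "(\<Sum>k\<le>m. \<Sum>l\<le>m. H k l * (of_nat k * \<mu> ^ (k - 1)) * \<nu> ^ l) =
      eval2 (ds F) (\<mu> + \<nu>) (\<mu> * \<nu>) + \<nu> * eval2 (dp F) (\<mu> + \<nu>) (\<mu> * \<nu>)" for \<mu> \<nu>
  proof (rule DERIV_unique)
    show "((\<lambda>\<mu>. \<Sum>k\<le>m. \<Sum>l\<le>m. H k l * \<mu> ^ k * \<nu> ^ l) has_field_derivative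
        (\<Sum>k\<le>m. \<Sum>l\<le>m. H k l * (of_nat k * \<mu> ^ (k - 1)) * \<nu> ^ l)) (at \<mu>)"
      by (intro DERIV_sum) (auto intro!: derivative_eq_intros)
    from DERIV_eval2[OF dmu, of F]
    show "((\<lambda>\<mu>. \<Sum>k\<le>m. \<Sum>l\<le>m. H k l * \<mu> ^ k * \<nu> ^ l) has_field_derivative
        (eval2 (ds F) (\<mu> + \<nu>) (\<mu> * \<nu>) + \<nu> * eval2 (dp F) (\<mu> + \<nu>) (\<mu> * \<nu>))) (at \<mu>)"
      unfolding f ds_def dp_def by simp
  qed
  \<comment> \<open>The chain rule yields the two mixed derivatives with factors \<nu> and \<mu>;
    once identified they combine to the factor \<mu> + \<nu>.\<close>
  have comm: "dp (ds F) = ds (dp F)"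
    by (intro poly_eqI) (simp add: ds_def dp_def coeff_map_poly coeff_pderiv pderiv_mult pderiv_of_nat del: of_nat_Suc)
  have C: "(\<Sum>k\<le>m. \<Sum>l\<le>m. H k l * (of_nat k * \<mu> ^ (k - 1)) * (of_nat l * \<nu> ^ (l - 1))) =
      eval2 (ds (ds F)) (\<mu> + \<nu>) (\<mu> * \<nu>) + (\<mu> + \<nu>) * eval2 (ds (dp F)) (\<mu> + \<nu>) (\<mu> * \<nu>)
      + \<mu> * \<nu> * eval2 (dp (dp F)) (\<mu> + \<nu>) (\<mu> * \<nu>) + eval2 (dp F) (\<mu> + \<nu>) (\<mu> * \<nu>)"
  proof (rule DERIV_unique)
    show "((\<lambda>\<mu>. \<Sum>k\<le>m. \<Sum>l\<le>m. H k l * \<mu> ^ k * (of_nat l * \<nu> ^ (l - 1))) has_field_derivative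
        (\<Sum>k\<le>m. \<Sum>l\<le>m. H k l * (of_nat k * \<mu> ^ (k - 1)) * (of_nat l * \<nu> ^ (l - 1)))) (at \<mu>)"
      by (intro DERIV_sum) (auto intro!: derivative_eq_intros)
    have "((\<lambda>\<mu>. eval2 (ds F) (\<mu> + \<nu>) (\<mu> * \<nu>) + \<mu> * eval2 (dp F) (\<mu> + \<nu>) (\<mu> * \<nu>)) has_field_derivative
        (1 * eval2 (ds (ds F)) (\<mu> + \<nu>) (\<mu> * \<nu>) + \<nu> * eval2 (dp (ds F)) (\<mu> + \<nu>) (\<mu> * \<nu>))
        + (1 * eval2 (dp F) (\<mu> + \<nu>) (\<mu> * \<nu>)
          + (1 * eval2 (ds (dp F)) (\<mu> + \<nu>) (\<mu> * \<nu>) + \<nu> * eval2 (dp (dp F)) (\<mu> + \<nu>) (\<mu> * \<nu>)) * \<mu>)) (at \<mu>)"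
      unfolding ds_def dp_def
      by (intro DERIV_add DERIV_mult DERIV_ident DERIV_eval2 dmu)
    then show "((\<lambda>\<mu>. \<Sum>k\<le>m. \<Sum>l\<le>m. H k l * \<mu> ^ k * (of_nat l * \<nu> ^ (l - 1))) has_field_derivative
        (eval2 (ds (ds F)) (\<mu> + \<nu>) (\<mu> * \<nu>) + (\<mu> + \<nu>) * eval2 (ds (dp F)) (\<mu> + \<nu>) (\<mu> * \<nu>)
      + \<mu> * \<nu> * eval2 (dp (dp F)) (\<mu> + \<nu>) (\<mu> * \<nu>) + eval2 (dp F) (\<mu> + \<nu>) (\<mu> * \<nu>))) (at \<mu>)"
      unfolding A comm by (rule DERIV_cong) (simp add: algebra_simps)
  qed
  show ?A unfolding p0 p1 E A ..
  show ?B unfolding p0 p1 E B ..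
  show ?C unfolding p1 E C ..
qed

end

section \<open>The effect of one additional row on the correlation\<close>

context iid_moments
begin

text \<open>Both determinants are expanded by \<open>det_gram_Suc\<close>. The row products
  \<open>x\<close> involve row n only, P and q only earlier rows, so every expectation factors and
  the row moments select the index patterns that survive.\<close>

lemma corr_Suc_expand:
  assumes n: "n < N" and c: "c ` {..<m} \<subseteq> {..<K}" "inj_on c {..<m}"
  defines "P \<equiv> \<lambda>\<mu> w. Determinant.det (gram n m (scalar_entries \<mu>) c c (\<lambda>p. Z p w))"
    and "q \<equiv> \<lambda>\<mu> i j w. cofactor (gram n m (scalar_entries \<mu>) c c (\<lambda>p. Z p w)) i j"
  shows "corr (Suc n) m c \<mu> \<nu> = corr n m c \<mu> \<nu>
      + (\<Sum>i<m. expectation (\<lambda>w. P \<mu> w * q \<nu> i i w)) + (\<Sum>i<m. expectation (\<lambda>w. q \<mu> i i w * P \<nu> w))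
      + (\<Sum>i<m. \<Sum>k<m. expectation (\<lambda>w. q \<mu> i i w * q \<nu> k k w))
      + (\<Sum>i<m. \<Sum>j<m. expectation (\<lambda>w. q \<mu> i j w * q \<nu> j i w))
      + \<beta> * (\<Sum>i<m. expectation (\<lambda>w. q \<mu> i i w * q \<nu> i i w))"
    and "\<And>i j k l. integrable M (\<lambda>w. q \<mu> i j w * q \<nu> k l w)"
    and "\<And>i j. integrable M (\<lambda>w. P \<mu> w * q \<nu> i j w)"
    and "\<And>i j. integrable M (\<lambda>w. q \<mu> i j w * P \<nu> w)"
proof -
  define x where "x i j w = cnj (Z (n, c i) w) * Z (n, c j) w" for i j w
  have cK: "c i < K" if "i < m" for i
    using c(1) that by auto
  \<comment> \<open>Injectivity turns equality of selected columns into equality of positions, so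
    the row moments become conditions on cofactor indices.\<close>
  have cij: "c i = c j \<longleftrightarrow> i = j" if "i < m" "j < m" for i j
    using c(2) that by (auto simp: inj_on_def)
  have cof: "square_integrable M (q \<mu> i j)" for \<mu> i j
    unfolding cofactor_gram q_def using n c(1)
    by (intro square_integrable_cmult square_integrable_det_gram) (auto simp: image_subset_iff insert_index_less)
  have dep_cof: "depends_on ({..<n} \<times> {..<K}) (q \<mu> i j)" for \<mu> i j
    unfolding cofactor_gram q_def using n c(1)
    by (intro depends_on_mult depends_on_const depends_on_det_gram) (auto simp: image_subset_iff insert_index_less)
  have sq: "square_integrable M (P \<mu>)" for \<mu>
    unfolding P_def using n c(1) by (intro square_integrable_det_gram) auto
  have dep: "depends_on ({..<n} \<times> {..<K}) (P \<mu>)" for \<mu>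
    unfolding P_def by (intro depends_on_det_gram c)
  have dep_x: "depends_on ({n} \<times> {..<K}) (x i j)" if "i < m" "j < m" for i j
    unfolding x_def using cK that
    by (intro depends_on_mult depends_on_cnj depends_on_entry) auto
  have x2: "integrable M (x i j)" "expectation (x i j) = (if i = j then 1 else 0)" if "i < m" "j < m" for i j
    unfolding x_def using row_moment_2[OF n cK[OF that(1)] cK[OF that(2)]] that by (auto simp: cij)
  have x4: "integrable M (\<lambda>w. x i j w * x k l w)"
    "expectation (\<lambda>w. x i j w * x k l w) = (if i = j \<and> k = l then 1 else 0) + (if i = l \<and> j = k then 1 else 0)
      + (if i = j \<and> j = k \<and> k = l then \<beta> else 0)"
    if "i < m" "j < m" "k < m" "l < m" for i j k l
    unfolding x_def using row_moment_4[OF n cK[OF that(1)] cK[OF that(2)] cK[OF that(3)] cK[OF that(4)]] that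
    by (auto simp: cij)
  have sets: "{n} \<times> {..<K} \<subseteq> {..<N} \<times> {..<K}" "{..<n} \<times> {..<K} \<subseteq> {..<N} \<times> {..<K}"
    "({n} \<times> {..<K}) \<inter> ({..<n} \<times> {..<K}) = {}"
    using n by auto
  note split_int = integrable_mult_disjoint[OF _ sets(1) _ _ sets(2) _ sets(3)]
  note split = expectation_mult_disjoint[OF _ sets(1) _ _ sets(2) _ sets(3)]
  show qq: "integrable M (\<lambda>w. q \<mu> i j w * q \<nu> k l w)" for i j k l
    by (intro square_integrable_mult_integrable cof)
  show Pq: "integrable M (\<lambda>w. P \<mu> w * q \<nu> i j w)" for i j
    by (intro square_integrable_mult_integrable cof sq)
  show qP: "integrable M (\<lambda>w. q \<mu> i j w * P \<nu> w)" for i j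
    by (intro square_integrable_mult_integrable cof sq)
  have PP: "integrable M (\<lambda>w. P \<mu> w * P \<nu> w)"
    by (intro square_integrable_mult_integrable sq)
  have xPq: "integrable M (\<lambda>w. x i j w * (P \<mu> w * q \<nu> i j w))"
    "expectation (\<lambda>w. x i j w * (P \<mu> w * q \<nu> i j w)) = (if i = j then 1 else 0) * expectation (\<lambda>w. P \<mu> w * q \<nu> i j w)"
    if "i < m" "j < m" for i j
    using split_int[OF dep_x[OF that] x2(1)[OF that] depends_on_mult[OF dep dep_cof] Pq]
      split[OF dep_x[OF that] x2(1)[OF that] depends_on_mult[OF dep dep_cof] Pq] x2(2)[OF that] by simp_all
  have xqP: "integrable M (\<lambda>w. x i j w * (q \<mu> i j w * P \<nu> w))"
    "expectation (\<lambda>w. x i j w * (q \<mu> i j w * P \<nu> w)) = (if i = j then 1 else 0) * expectation (\<lambda>w. q \<mu> i j w * P \<nu> w)"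
    if "i < m" "j < m" for i j
    using split_int[OF dep_x[OF that] x2(1)[OF that] depends_on_mult[OF dep_cof dep] qP]
      split[OF dep_x[OF that] x2(1)[OF that] depends_on_mult[OF dep_cof dep] qP] x2(2)[OF that] by simp_all
  have xxqq: "integrable M (\<lambda>w. x i j w * x k l w * (q \<mu> i j w * q \<nu> k l w))"
    "expectation (\<lambda>w. x i j w * x k l w * (q \<mu> i j w * q \<nu> k l w)) =
      ((if i = j \<and> k = l then 1 else 0) + (if i = l \<and> j = k then 1 else 0)
      + (if i = j \<and> j = k \<and> k = l then \<beta> else 0)) * expectation (\<lambda>w. q \<mu> i j w * q \<nu> k l w)"
    if "i < m" "j < m" "k < m" "l < m" for i j k l
    using split_int[OF depends_on_mult[OF dep_x dep_x] x4(1)[OF that] depends_on_mult[OF dep_cof dep_cof] qq]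
      split[OF depends_on_mult[OF dep_x dep_x] x4(1)[OF that] depends_on_mult[OF dep_cof dep_cof] qq]
      x4(2)[OF that] that by simp_all
  have det: "Determinant.det (gram (Suc n) m (scalar_entries \<mu>) c c (\<lambda>p. Z p w)) =
      P \<mu> w + (\<Sum>i<m. \<Sum>j<m. x i j w * q \<mu> i j w)" for \<mu> w
    by (simp add: det_gram_Suc P_def q_def x_def)
  have prod: "(P \<mu> w + (\<Sum>i<m. \<Sum>j<m. x i j w * q \<mu> i j w)) * (P \<nu> w + (\<Sum>i<m. \<Sum>j<m. x i j w * q \<nu> i j w)) =
      P \<mu> w * P \<nu> w + (\<Sum>i<m. \<Sum>j<m. x i j w * (P \<mu> w * q \<nu> i j w)) + (\<Sum>i<m. \<Sum>j<m. x i j w * (q \<mu> i j w * P \<nu> w))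
      + (\<Sum>i<m. \<Sum>j<m. \<Sum>k<m. \<Sum>l<m. x i j w * x k l w * (q \<mu> i j w * q \<nu> k l w))" for w
  proof -
    have "(\<Sum>i<m. \<Sum>j<m. x i j w * q \<mu> i j w) * (\<Sum>k<m. \<Sum>l<m. x k l w * q \<nu> k l w) =
        (\<Sum>i<m. \<Sum>j<m. \<Sum>k<m. \<Sum>l<m. x i j w * x k l w * (q \<mu> i j w * q \<nu> k l w))"
      by (simp only: sum_distrib_right) (simp add: sum_distrib_left ac_simps)
    moreover have "P \<mu> w * (\<Sum>i<m. \<Sum>j<m. x i j w * q \<nu> i j w) = (\<Sum>i<m. \<Sum>j<m. x i j w * (P \<mu> w * q \<nu> i j w))"
      by (simp add: sum_distrib_left ac_simps)
    moreover have "(\<Sum>i<m. \<Sum>j<m. x i j w * q \<mu> i j w) * P \<nu> w = (\<Sum>i<m. \<Sum>j<m. x i j w * (q \<mu> i j w * P \<nu> w))"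
      by (simp add: sum_distrib_right mult.assoc)
    ultimately show ?thesis by (simp add: distrib_left distrib_right)
  qed
  have add4: "expectation (\<lambda>w. f1 w + f2 w + f3 w + f4 w) = expectation f1 + expectation f2 + expectation f3 + expectation f4"
    if "integrable M f1" "integrable M f2" "integrable M f3" "integrable M f4" for f1 f2 f3 f4 :: "'w \<Rightarrow> complex"
    using that by simp
  have S1: "integrable M (\<lambda>w. \<Sum>i<m. \<Sum>j<m. x i j w * (P \<mu> w * q \<nu> i j w))"
    "expectation (\<lambda>w. \<Sum>i<m. \<Sum>j<m. x i j w * (P \<mu> w * q \<nu> i j w)) = (\<Sum>i<m. expectation (\<lambda>w. P \<mu> w * q \<nu> i i w))"
  proof -
    show "integrable M (\<lambda>w. \<Sum>i<m. \<Sum>j<m. x i j w * (P \<mu> w * q \<nu> i j w))"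
      by (rule integrable_sum2) (rule xPq(1); simp)
    have "expectation (\<lambda>w. \<Sum>i<m. \<Sum>j<m. x i j w * (P \<mu> w * q \<nu> i j w)) =
        (\<Sum>i<m. \<Sum>j<m. expectation (\<lambda>w. x i j w * (P \<mu> w * q \<nu> i j w)))"
      by (rule integral_sum2) (rule xPq(1); simp)
    also have "\<dots> = (\<Sum>i<m. \<Sum>j<m. if i = j then expectation (\<lambda>w. P \<mu> w * q \<nu> i j w) else 0)"
      by (intro sum.cong refl) (simp add: xPq(2))
    finally show "expectation (\<lambda>w. \<Sum>i<m. \<Sum>j<m. x i j w * (P \<mu> w * q \<nu> i j w)) =
        (\<Sum>i<m. expectation (\<lambda>w. P \<mu> w * q \<nu> i i w))"
      by simp
  qed
  have S2: "integrable M (\<lambda>w. \<Sum>i<m. \<Sum>j<m. x i j w * (q \<mu> i j w * P \<nu> w))"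
    "expectation (\<lambda>w. \<Sum>i<m. \<Sum>j<m. x i j w * (q \<mu> i j w * P \<nu> w)) = (\<Sum>i<m. expectation (\<lambda>w. q \<mu> i i w * P \<nu> w))"
  proof -
    show "integrable M (\<lambda>w. \<Sum>i<m. \<Sum>j<m. x i j w * (q \<mu> i j w * P \<nu> w))"
      by (rule integrable_sum2) (rule xqP(1); simp)
    have "expectation (\<lambda>w. \<Sum>i<m. \<Sum>j<m. x i j w * (q \<mu> i j w * P \<nu> w)) =
        (\<Sum>i<m. \<Sum>j<m. expectation (\<lambda>w. x i j w * (q \<mu> i j w * P \<nu> w)))"
      by (rule integral_sum2) (rule xqP(1); simp)
    also have "\<dots> = (\<Sum>i<m. \<Sum>j<m. if i = j then expectation (\<lambda>w. q \<mu> i j w * P \<nu> w) else 0)"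
      by (intro sum.cong refl) (simp add: xqP(2))
    finally show "expectation (\<lambda>w. \<Sum>i<m. \<Sum>j<m. x i j w * (q \<mu> i j w * P \<nu> w)) =
        (\<Sum>i<m. expectation (\<lambda>w. q \<mu> i i w * P \<nu> w))"
      by simp
  qed
  have S3: "integrable M (\<lambda>w. \<Sum>i<m. \<Sum>j<m. \<Sum>k<m. \<Sum>l<m. x i j w * x k l w * (q \<mu> i j w * q \<nu> k l w))"
    "expectation (\<lambda>w. \<Sum>i<m. \<Sum>j<m. \<Sum>k<m. \<Sum>l<m. x i j w * x k l w * (q \<mu> i j w * q \<nu> k l w)) =
      (\<Sum>i<m. \<Sum>j<m. \<Sum>k<m. \<Sum>l<m. ((if i = j \<and> k = l then 1 else 0) + (if i = l \<and> j = k then 1 else 0)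
      + (if i = j \<and> j = k \<and> k = l then \<beta> else 0)) * expectation (\<lambda>w. q \<mu> i j w * q \<nu> k l w))"
  proof -
    have int: "integrable M (\<lambda>w. \<Sum>k<m. \<Sum>l<m. x i j w * x k l w * (q \<mu> i j w * q \<nu> k l w))"
      if "i < m" "j < m" for i j
      by (rule integrable_sum2) (rule xxqq(1); simp add: that)
    show "integrable M (\<lambda>w. \<Sum>i<m. \<Sum>j<m. \<Sum>k<m. \<Sum>l<m. x i j w * x k l w * (q \<mu> i j w * q \<nu> k l w))"
      by (rule integrable_sum2) (rule int; simp)
    have "expectation (\<lambda>w. \<Sum>i<m. \<Sum>j<m. \<Sum>k<m. \<Sum>l<m. x i j w * x k l w * (q \<mu> i j w * q \<nu> k l w)) =
        (\<Sum>i<m. \<Sum>j<m. expectation (\<lambda>w. \<Sum>k<m. \<Sum>l<m. x i j w * x k l w * (q \<mu> i j w * q \<nu> k l w)))"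
      by (rule integral_sum2) (rule int; simp)
    also have "\<dots> = (\<Sum>i<m. \<Sum>j<m. \<Sum>k<m. \<Sum>l<m. expectation (\<lambda>w. x i j w * x k l w * (q \<mu> i j w * q \<nu> k l w)))"
      by (intro sum.cong refl integral_sum2) (rule xxqq(1); simp)
    also have "\<dots> = (\<Sum>i<m. \<Sum>j<m. \<Sum>k<m. \<Sum>l<m. ((if i = j \<and> k = l then 1 else 0) + (if i = l \<and> j = k then 1 else 0)
      + (if i = j \<and> j = k \<and> k = l then \<beta> else 0)) * expectation (\<lambda>w. q \<mu> i j w * q \<nu> k l w))"
      by (intro sum.cong refl xxqq(2)) simp_all
    finally show "expectation (\<lambda>w. \<Sum>i<m. \<Sum>j<m. \<Sum>k<m. \<Sum>l<m. x i j w * x k l w * (q \<mu> i j w * q \<nu> k l w)) =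
      (\<Sum>i<m. \<Sum>j<m. \<Sum>k<m. \<Sum>l<m. ((if i = j \<and> k = l then 1 else 0) + (if i = l \<and> j = k then 1 else 0)
      + (if i = j \<and> j = k \<and> k = l then \<beta> else 0)) * expectation (\<lambda>w. q \<mu> i j w * q \<nu> k l w))" .
  qed
  show "corr (Suc n) m c \<mu> \<nu> = corr n m c \<mu> \<nu>
      + (\<Sum>i<m. expectation (\<lambda>w. P \<mu> w * q \<nu> i i w)) + (\<Sum>i<m. expectation (\<lambda>w. q \<mu> i i w * P \<nu> w))
      + (\<Sum>i<m. \<Sum>k<m. expectation (\<lambda>w. q \<mu> i i w * q \<nu> k k w))
      + (\<Sum>i<m. \<Sum>j<m. expectation (\<lambda>w. q \<mu> i j w * q \<nu> j i w))
      + \<beta> * (\<Sum>i<m. expectation (\<lambda>w. q \<mu> i i w * q \<nu> i i w))"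
    unfolding corr_def det prod add4[OF PP S1(1) S2(1) S3(1)] S1(2) S2(2) S3(2) sum_pairings
    by (simp only: P_def add.assoc)
qed

text \<open>The mixed derivative and the trace of the product of adjugates contribute one F_p each,
  which explains the 2 F_p in \<open>rec_op\<close>.\<close>

lemma corr_Suc:
  assumes n: "n < N" and c: "c ` {..<m} \<subseteq> {..<K}" "inj_on c {..<m}"
    and F: "\<And>\<mu> \<nu>. corr n m c \<mu> \<nu> = eval2 F (\<mu> + \<nu>) (\<mu> * \<nu>)"
    and G: "\<And>i. i < m \<Longrightarrow> corr n (m - 1) (c \<circ> insert_index i) \<mu> \<nu> = eval2 G (\<mu> + \<nu>) (\<mu> * \<nu>)"
    and neq: "\<mu> \<noteq> \<nu>"
  shows "corr (Suc n) m c \<mu> \<nu> =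
    eval2 (rec_op F + Polynomial.smult [:\<beta> * of_nat m:] G) (\<mu> + \<nu>) (\<mu> * \<nu>)"
proof -
  define P where "P \<mu> w = Determinant.det (gram n m (scalar_entries \<mu>) c c (\<lambda>p. Z p w))" for \<mu> w
  define q where "q \<mu> i j w = cofactor (gram n m (scalar_entries \<mu>) c c (\<lambda>p. Z p w)) i j" for \<mu> i j w
  let ?ev = "\<lambda>F. eval2 F (\<mu> + \<nu>) (\<mu> * \<nu>)"
  let ?ds = "pderiv :: complex poly poly \<Rightarrow> complex poly poly" and ?dp = "map_poly pderiv :: complex poly poly \<Rightarrow> complex poly poly"
  note expand = corr_Suc_expand[OF n c, folded P_def q_def]
  note int = expand(2-4)
  have P: "P \<mu> w = (-1) ^ m * poly (chi n m c w) \<mu>" for \<mu> w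
    unfolding P_def det_gram_scalar chi_def ..
  have tr: "(\<Sum>i<m. q \<mu> i i w) = - ((-1) ^ m * poly (pderiv (chi n m c w)) \<mu>)" for \<mu> w
    unfolding q_def sum_cofactor_gram_scalar chi_def ..
  have le: "n \<le> N" using n by simp
  note D = expectation_chi_pderiv[OF le c(1) F]
  have E1: "(\<Sum>i<m. expectation (\<lambda>w. P \<mu> w * q \<nu> i i w)) = - (?ev (?ds F) + \<mu> * ?ev (?dp F))"
  proof -
    have "(\<Sum>i<m. expectation (\<lambda>w. P \<mu> w * q \<nu> i i w)) = expectation (\<lambda>w. P \<mu> w * (\<Sum>i<m. q \<nu> i i w))"
      unfolding sum_distrib_left by (rule Bochner_Integration.integral_sum[symmetric]) (rule int)
    also have "\<dots> = expectation (\<lambda>w. - (poly (chi n m c w) \<mu> * poly (pderiv (chi n m c w)) \<nu>))"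
      unfolding P tr by (simp add: minus_one_power_iff)
    finally show ?thesis using D(1) by simp
  qed
  have E2: "(\<Sum>i<m. expectation (\<lambda>w. q \<mu> i i w * P \<nu> w)) = - (?ev (?ds F) + \<nu> * ?ev (?dp F))"
  proof -
    have "(\<Sum>i<m. expectation (\<lambda>w. q \<mu> i i w * P \<nu> w)) = expectation (\<lambda>w. (\<Sum>i<m. q \<mu> i i w) * P \<nu> w)"
      unfolding sum_distrib_right by (rule Bochner_Integration.integral_sum[symmetric]) (rule int)
    also have "\<dots> = expectation (\<lambda>w. - (poly (pderiv (chi n m c w)) \<mu> * poly (chi n m c w) \<nu>))"
      unfolding P tr by (simp add: minus_one_power_iff)
    finally show ?thesis using D(2) by simp
  qed
  have E3: "(\<Sum>i<m. \<Sum>k<m. expectation (\<lambda>w. q \<mu> i i w * q \<nu> k k w)) =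
      ?ev (?ds (?ds F)) + (\<mu> + \<nu>) * ?ev (?ds (?dp F)) + \<mu> * \<nu> * ?ev (?dp (?dp F)) + ?ev (?dp F)"
  proof -
    have "(\<Sum>i<m. \<Sum>k<m. expectation (\<lambda>w. q \<mu> i i w * q \<nu> k k w)) =
        expectation (\<lambda>w. (\<Sum>i<m. q \<mu> i i w) * (\<Sum>k<m. q \<nu> k k w))"
      unfolding sum_product by (rule integral_sum2[symmetric]) (rule int)
    also have "\<dots> = expectation (\<lambda>w. poly (pderiv (chi n m c w)) \<mu> * poly (pderiv (chi n m c w)) \<nu>)"
      unfolding tr by (simp add: minus_one_power_iff)
    finally show ?thesis using D(3) by simp
  qed
  \<comment> \<open>By the trace identity with d = \<mu> - \<nu>, multiplying this sum by d gives
    the average in E2 minus the one in E1. Only (\<mu> - \<nu>) F_p survives, and d can be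
    cancelled.\<close>
  have E4: "(\<Sum>i<m. \<Sum>j<m. expectation (\<lambda>w. q \<mu> i j w * q \<nu> j i w)) = ?ev (?dp F)"
  proof -
    have shift: "gram n m (scalar_entries \<nu>) c c z = gram n m (scalar_entries \<mu>) c c z + (\<mu> - \<nu>) \<cdot>\<^sub>m 1\<^sub>m m" for z
      by (rule eq_matI) (auto simp: gram_def scalar_entries_def)
    have tr4: "(\<mu> - \<nu>) * (\<Sum>i<m. \<Sum>j<m. q \<mu> i j w * q \<nu> j i w) =
        (\<Sum>i<m. q \<mu> i i w * P \<nu> w) - (\<Sum>i<m. P \<mu> w * q \<nu> i i w)" for w
      using trace_adj_mult_adj_shift[OF gram_carrier shift]
      by (simp add: q_def P_def sum_distrib_left mult.commute)
    have "(\<mu> - \<nu>) * (\<Sum>i<m. \<Sum>j<m. expectation (\<lambda>w. q \<mu> i j w * q \<nu> j i w)) =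
        expectation (\<lambda>w. (\<mu> - \<nu>) * (\<Sum>i<m. \<Sum>j<m. q \<mu> i j w * q \<nu> j i w))"
      unfolding integral_mult_right_zero by (subst integral_sum2) (rule int refl)+
    also have "\<dots> = (\<Sum>i<m. expectation (\<lambda>w. q \<mu> i i w * P \<nu> w)) - (\<Sum>i<m. expectation (\<lambda>w. P \<mu> w * q \<nu> i i w))"
      unfolding tr4
      by (subst Bochner_Integration.integral_diff, (intro Bochner_Integration.integrable_sum int)+,
          (subst Bochner_Integration.integral_sum, rule int)+, rule refl)
    also have "\<dots> = (\<mu> - \<nu>) * ?ev (?dp F)"
      unfolding E1 E2 by (simp add: algebra_simps)
    finally show ?thesis using neq by simp
  qed
  \<comment> \<open>The cofactor signs cancel in the product, and each diagonal minor is the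
    determinant with column i deleted, whose correlation by G is the same for all i.\<close>
  have E5: "(\<Sum>i<m. expectation (\<lambda>w. q \<mu> i i w * q \<nu> i i w)) = of_nat m * ?ev G"
  proof -
    have "expectation (\<lambda>w. q \<mu> i i w * q \<nu> i i w) = ?ev G" if "i < m" for i
    proof -
      have "expectation (\<lambda>w. q \<mu> i i w * q \<nu> i i w) = corr n (m - 1) (c \<circ> insert_index i) \<mu> \<nu>"
        unfolding q_def cofactor_gram scalar_entries_insert_index corr_def sign_cancel ..
      then show ?thesis using G[OF that] by simp
    qed
    then show ?thesis by simp
  qed
  show ?thesis
    unfolding expand(1) E1 E2 E3 E4 E5 F rec_op_def
    by (simp add: algebra_simps numeral_poly)
qed

lemma isCont_eval2: "isCont (\<lambda>\<nu>. eval2 F (\<mu> + \<nu>) (\<mu> * \<nu>)) \<nu>"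
proof -
  have "((\<lambda>\<nu>. \<mu> + \<nu>) has_field_derivative 1) (at \<nu>)" "((\<lambda>\<nu>. \<mu> * \<nu>) has_field_derivative \<mu>) (at \<nu>)"
    by (auto intro!: derivative_eq_intros)
  from DERIV_isCont[OF DERIV_eval2[OF this]] show ?thesis .
qed

lemma isCont_corr:
  assumes "n \<le> N" "c ` {..<m} \<subseteq> {..<K}"
  shows "isCont (\<lambda>\<nu>. corr n m c \<mu> \<nu>) \<nu>"
proof -
  have p0: "poly (chi n m c w) x = (\<Sum>k\<le>m. coeff (chi n m c w) k * x ^ k)" for w x
    by (rule poly_eq_sum_bound) (simp add: degree_chi)
  show ?thesis
    unfolding corr_eq_chi p0 expectation_coeff_chi[OF assms] by (intro continuous_intros)
qed

text \<open>The recursion step cancels \<mu> - \<nu>, so the case \<mu> = \<nu> is recovered by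
  continuity in \<nu>. Quantifying over all injective selections c makes the induction hypothesis
  available after a column is deleted.\<close>

lemma corr_eq_corr_poly:
  assumes "n \<le> N" "c ` {..<m} \<subseteq> {..<K}" "inj_on c {..<m}"
  shows "corr n m c \<mu> \<nu> = eval2 (corr_poly \<beta> n m) (\<mu> + \<nu>) (\<mu> * \<nu>)"
  using assms
proof (induction n arbitrary: m c \<mu> \<nu>)
  case 0
  have "Determinant.det (gram 0 m (scalar_entries \<mu>) c c z) = (- \<mu>) ^ m" for \<mu> z
  proof -
    have "gram 0 m (scalar_entries \<mu>) c c z = (- \<mu>) \<cdot>\<^sub>m 1\<^sub>m m"
      by (rule eq_matI) (auto simp: gram_def scalar_entries_def)
    then show ?thesis by simp
  qed
  then show ?case
    by (simp add: corr_def prob_space poly_monom power_mult_distrib[symmetric])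
next
  case (Suc n)
  have n: "n < N" and le: "n \<le> N" using Suc.prems(1) by auto
  have G: "corr n (m - 1) (c \<circ> insert_index i) \<mu> \<nu> = eval2 (corr_poly \<beta> n (m - 1)) (\<mu> + \<nu>) (\<mu> * \<nu>)"
    if "i < m" for i \<mu> \<nu>
  proof (rule Suc.IH[OF le])
    show "(c \<circ> insert_index i) ` {..<m - 1} \<subseteq> {..<K}"
      using Suc.prems(2) by (auto simp: image_subset_iff insert_index_less)
    have "inj_on c (insert_index i ` {..<m - 1})"
      using Suc.prems(3) by (rule inj_on_subset) (auto simp: insert_index_less)
    then show "inj_on (c \<circ> insert_index i) {..<m - 1}"
      by (intro comp_inj_on insert_index_inj_on)
  qed
  have ne: "corr (Suc n) m c \<mu> \<nu> = eval2 (corr_poly \<beta> (Suc n) m) (\<mu> + \<nu>) (\<mu> * \<nu>)" if "\<mu> \<noteq> \<nu>" for \<mu> \<nu>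
    using corr_Suc[OF n Suc.prems(2,3) Suc.IH[OF le Suc.prems(2,3)] G that] by simp
  show ?case
  proof (cases "\<mu> = \<nu>")
    case False
    then show ?thesis by (rule ne)
  next
    case True
    have "isCont (\<lambda>\<nu>. corr (Suc n) m c \<mu> \<nu>) \<mu>"
      by (rule isCont_corr[OF Suc.prems(1,2)])
    then have "((\<lambda>\<nu>. corr (Suc n) m c \<mu> \<nu>) \<longlongrightarrow> corr (Suc n) m c \<mu> \<mu>) (at \<mu>)"
      by (simp add: isCont_def)
    moreover have "((\<lambda>\<nu>. corr (Suc n) m c \<mu> \<nu>) \<longlongrightarrow> eval2 (corr_poly \<beta> (Suc n) m) (\<mu> + \<mu>) (\<mu> * \<mu>)) (at \<mu>)"
    proof (rule Lim_transform_eventually)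
      show "((\<lambda>\<nu>. eval2 (corr_poly \<beta> (Suc n) m) (\<mu> + \<nu>) (\<mu> * \<nu>)) \<longlongrightarrow> eval2 (corr_poly \<beta> (Suc n) m) (\<mu> + \<mu>) (\<mu> * \<mu>)) (at \<mu>)"
        using isCont_eval2 unfolding isCont_def .
      show "\<forall>\<^sub>F \<nu> in at \<mu>. eval2 (corr_poly \<beta> (Suc n) m) (\<mu> + \<nu>) (\<mu> * \<nu>) = corr (Suc n) m c \<mu> \<nu>"
        unfolding eventually_at_filter by (rule always_eventually) (metis ne)
    qed
    ultimately show ?thesis
      unfolding True using tendsto_unique[OF trivial_limit_at] by blast
  qed
qed

end

section \<open>The sample covariance matrix\<close>

lemma integrable_power_le:
  fixes Q :: "real measure"
  assumes Q: "real_distribution Q" and int: "integrable Q (\<lambda>x. x ^ 4)" and k: "k \<le> 4"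
  shows "integrable Q (\<lambda>x. x ^ k)"
proof -
  interpret Q: real_distribution Q by (rule Q)
  have "\<bar>x\<bar> ^ k \<le> 1 + x ^ 4" for x :: real
  proof (cases "\<bar>x\<bar> \<le> 1")
    case True
    then have "\<bar>x\<bar> ^ k \<le> 1" by (simp add: power_le_one)
    moreover have "0 \<le> x ^ 4" by simp
    ultimately show ?thesis by linarith
  next
    case False
    then have "\<bar>x\<bar> ^ k \<le> \<bar>x\<bar> ^ 4" using k by (intro power_increasing) auto
    moreover have "\<bar>x\<bar> ^ 4 = x ^ 4" by (rule power_even_abs) simp
    ultimately show ?thesis by linarith
  qed
  then have "norm (x ^ k) \<le> norm (1 + x ^ 4)" for x :: real
    unfolding real_norm_def power_abs by (rule order_trans[OF _ abs_ge_self])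
  then have ae: "AE x in Q. norm (x ^ k) \<le> norm (1 + x ^ 4)"
    by (rule AE_I2)
  have i: "integrable Q (\<lambda>x. 1 + x ^ 4)" using int by simp
  show ?thesis
    by (rule Bochner_Integration.integrable_bound[OF i _ ae]) measurable
qed

text \<open>For z = x + i y, equal second moments and zero means make E z^2 vanish, and E |z|^4 = 2
  b + 2 (1/2)^2 = 2 (b - 3/4) + 2. Here 3/4 is the fourth moment of a real Gaussian with variance
  1/2.\<close>

lemma (in prob_space) complex_moments_of_law:
  fixes Q :: "real measure" and z :: "'a \<Rightarrow> complex"
  assumes Q: "real_distribution Q"
    and fourth_moment: "integrable Q (\<lambda>x. x ^ 4)"
    and mean: "prob_space.expectation Q (\<lambda>x. x) = 0"
    and variance: "prob_space.variance Q (\<lambda>x. x) = 1 / 2"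
    and ind: "indep_var borel (\<lambda>w. Re (z w)) borel (\<lambda>w. Im (z w))"
    and law: "distr M borel (\<lambda>w. Re (z w)) = Q" "distr M borel (\<lambda>w. Im (z w)) = Q"
  shows "integrable M (\<lambda>w. norm (z w) ^ 4)"
    and "expectation z = 0"
    and "expectation (\<lambda>w. z w ^ 2) = 0"
    and "expectation (\<lambda>w. z w * cnj (z w)) = 1"
    and "expectation (\<lambda>w. z w ^ 2 * cnj (z w) ^ 2) =
      complex_of_real (2 * (prob_space.expectation Q (\<lambda>x. x ^ 4) - 3 / 4)) + 2"
proof -
  interpret Q: real_distribution Q by (rule Q)
  define x where "x w = Re (z w)" for w
  define y where "y w = Im (z w)" for w
  define b where "b = Q.expectation (\<lambda>x. x ^ 4)"
  have z: "z w = Complex (x w) (y w)" for w by (simp add: x_def y_def)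
  have [measurable]: "x \<in> borel_measurable M" "y \<in> borel_measurable M"
    using indep_var_rv1[OF ind] indep_var_rv2[OF ind] by (simp_all add: x_def[abs_def] y_def[abs_def])
  have ind': "indep_var borel x borel y"
    using ind by (simp add: x_def[abs_def] y_def[abs_def])
  have law': "distr M borel x = Q" "distr M borel y = Q"
    using law by (simp_all add: x_def[abs_def] y_def[abs_def])
  have ix: "integrable M (\<lambda>w. x w ^ k)" if "k \<le> 4" for k
    using integrable_power_le[OF Q fourth_moment that]
    unfolding law'(1)[symmetric] by (subst (asm) integrable_distr_eq) simp_all
  have iy: "integrable M (\<lambda>w. y w ^ k)" if "k \<le> 4" for k
    using integrable_power_le[OF Q fourth_moment that]
    unfolding law'(2)[symmetric] by (subst (asm) integrable_distr_eq) simp_all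
  have ex: "expectation (\<lambda>w. x w ^ k) = Q.expectation (\<lambda>x. x ^ k)" for k
    unfolding law'(1)[symmetric] by (subst integral_distr) simp_all
  have ey: "expectation (\<lambda>w. y w ^ k) = Q.expectation (\<lambda>x. x ^ k)" for k
    unfolding law'(2)[symmetric] by (subst integral_distr) simp_all
  have ind_pow: "indep_var borel (\<lambda>w. x w ^ k) borel (\<lambda>w. y w ^ l)" for k l
    using indep_var_compose[OF ind', of "\<lambda>t. t ^ k" borel "\<lambda>t. t ^ l" borel] by (simp add: o_def)
  have ixy: "integrable M (\<lambda>w. x w ^ k * y w ^ l)" if "k \<le> 4" "l \<le> 4" for k l
    using indep_var_integrable[OF ind_pow ix[OF that(1)] iy[OF that(2)]] .
  have exy: "expectation (\<lambda>w. x w ^ k * y w ^ l) = Q.expectation (\<lambda>x. x ^ k) * Q.expectation (\<lambda>x. x ^ l)"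
    if "k \<le> 4" "l \<le> 4" for k l
    using indep_var_lebesgue_integral[OF ind_pow ix[OF that(1)] iy[OF that(2)]] by (simp add: ex ey)
  have q1: "Q.expectation (\<lambda>x. x ^ 1) = 0"
    using mean by simp
  have q2: "Q.expectation (\<lambda>x. x ^ 2) = 1 / 2"
    using variance by (simp add: mean)
  have i2: "integrable M (\<lambda>w. x w ^ 2)" "integrable M (\<lambda>w. y w ^ 2)" "integrable M (\<lambda>w. x w * y w)"
    using ix[of 2] iy[of 2] ixy[of 1 1] by simp_all
  have i1: "integrable M x" "integrable M y"
    using ix[of 1] iy[of 1] by simp_all
  have i4: "integrable M (\<lambda>w. x w ^ 4)" "integrable M (\<lambda>w. y w ^ 4)" "integrable M (\<lambda>w. x w ^ 2 * y w ^ 2)"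
    using ix[of 4] iy[of 4] ixy[of 2 2] by simp_all
  have n4: "norm (z w) ^ 4 = x w ^ 4 + 2 * (x w ^ 2 * y w ^ 2) + y w ^ 4" for w
  proof -
    have "norm (z w) ^ 4 = (norm (z w) ^ 2) ^ 2" by (simp add: power_mult[symmetric])
    also have "\<dots> = (x w ^ 2 + y w ^ 2) ^ 2" by (simp add: cmod_power2 x_def y_def)
    also have "\<dots> = x w ^ 4 + 2 * (x w ^ 2 * y w ^ 2) + y w ^ 4"
      by (simp add: power2_sum power_mult[symmetric])
    finally show ?thesis .
  qed
  show "integrable M (\<lambda>w. norm (z w) ^ 4)"
    unfolding n4 using i4 by simp
  have zeq: "z w = of_real (x w) + \<i> * of_real (y w)" for w
    by (simp add: z complex_eq_iff)
  show "expectation z = 0"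
  proof -
    have "expectation z = expectation (\<lambda>w. of_real (x w) + \<i> * of_real (y w))"
      by (simp add: zeq[symmetric])
    also have "\<dots> = of_real (expectation x) + \<i> * of_real (expectation y)"
      using i1 by simp
    also have "\<dots> = 0" using ex[of 1] ey[of 1] q1 by simp
    finally show ?thesis .
  qed
  have "z w ^ 2 = of_real (x w ^ 2) - of_real (y w ^ 2) + 2 * \<i> * of_real (x w * y w)" for w
    by (simp add: zeq power2_eq_square algebra_simps)
  then have "expectation (\<lambda>w. z w ^ 2) =
      of_real (expectation (\<lambda>w. x w ^ 2)) - of_real (expectation (\<lambda>w. y w ^ 2)) + 2 * \<i> * of_real (expectation (\<lambda>w. x w * y w))"
    using i2 by (simp del: of_real_power of_real_mult)
  also have "\<dots> = 0"
    using exy[of 1 1] q1 by (simp add: ex ey)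
  finally show "expectation (\<lambda>w. z w ^ 2) = 0" .
  have "z w * cnj (z w) = of_real (x w ^ 2 + y w ^ 2)" for w
    by (simp add: complex_mult_cnj x_def y_def)
  then have "expectation (\<lambda>w. z w * cnj (z w)) = of_real (expectation (\<lambda>w. x w ^ 2 + y w ^ 2))"
    by (simp del: of_real_add of_real_power)
  also have "\<dots> = 1"
    using i2 by (simp add: ex ey q2)
  finally show "expectation (\<lambda>w. z w * cnj (z w)) = 1" .
  have "z w ^ 2 * cnj (z w) ^ 2 = of_real (norm (z w) ^ 4)" for w
  proof -
    have "z w ^ 2 * cnj (z w) ^ 2 = (z w * cnj (z w)) ^ 2" by (simp add: power_mult_distrib)
    also have "\<dots> = of_real (norm (z w) ^ 2) ^ 2" by (simp only: complex_norm_square)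
    finally show ?thesis by (simp add: power_mult[symmetric])
  qed
  then have "expectation (\<lambda>w. z w ^ 2 * cnj (z w) ^ 2) = of_real (expectation (\<lambda>w. x w ^ 4 + 2 * (x w ^ 2 * y w ^ 2) + y w ^ 4))"
    unfolding n4 by (simp only: integral_complex_of_real)
  also have "expectation (\<lambda>w. x w ^ 4 + 2 * (x w ^ 2 * y w ^ 2) + y w ^ 4) = 2 * (b - 3 / 4) + 2"
    using i4 exy[of 2 2] by (simp add: ex ey q2 b_def)
  finally show "expectation (\<lambda>w. z w ^ 2 * cnj (z w) ^ 2) =
      complex_of_real (2 * (prob_space.expectation Q (\<lambda>x. x ^ 4) - 3 / 4)) + 2"
    by (simp add: b_def)
qed

lemma iid_complex_matrix_moments:
  assumes X: "iid_complex_matrix Q M n m X"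
    and Q: "real_distribution Q"
    and fourth_moment: "integrable Q (\<lambda>x. x ^ 4)"
    and mean: "prob_space.expectation Q (\<lambda>x. x) = 0"
    and variance: "prob_space.variance Q (\<lambda>x. x) = 1 / 2"
  shows "iid_moments M (\<lambda>p w. X w $$ p) n m
    (complex_of_real (2 * (prob_space.expectation Q (\<lambda>x. x ^ 4) - 3 / 4)))"
proof -
  interpret prob_space M using X by (simp add: iid_complex_matrix_def)
  have X': "indep_vars (\<lambda>_. borel) (\<lambda>(i, j) w. X w $$ (i, j)) ({..<n} \<times> {..<m})"
    and law: "\<And>i j. i < n \<Longrightarrow> j < m \<Longrightarrow>
      indep_var borel (\<lambda>w. Re (X w $$ (i, j))) borel (\<lambda>w. Im (X w $$ (i, j))) \<and>
      distr M borel (\<lambda>w. Re (X w $$ (i, j))) = Q \<and> distr M borel (\<lambda>w. Im (X w $$ (i, j))) = Q"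
    using X by (auto simp: iid_complex_matrix_def)
  have split_eq: "(\<lambda>(i, j) w. X w $$ (i, j)) = (\<lambda>p w. X w $$ p)"
    by (auto simp: fun_eq_iff)
  note mom = complex_moments_of_law[OF Q fourth_moment mean variance]
  have entry: "indep_var borel (\<lambda>w. Re (X w $$ p)) borel (\<lambda>w. Im (X w $$ p))"
    "distr M borel (\<lambda>w. Re (X w $$ p)) = Q" "distr M borel (\<lambda>w. Im (X w $$ p)) = Q"
    if "p \<in> {..<n} \<times> {..<m}" for p
    using that law by (cases p, simp)+
  show ?thesis
  proof
    show "indep_vars (\<lambda>_. borel) (\<lambda>p w. X w $$ p) ({..<n} \<times> {..<m})"
      using X' unfolding split_eq .
  qed (rule mom(1)[OF entry] mom(2)[OF entry] mom(3)[OF entry] mom(4)[OF entry] mom(5)[OF entry], assumption+)+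
qed

lemma sample_covariance_eq_gram:
  assumes "A \<in> carrier_mat n m"
  shows "sample_covariance A - \<mu> \<cdot>\<^sub>m 1\<^sub>m (dim_row (sample_covariance A)) = gram n m (scalar_entries \<mu>) id id (\<lambda>p. A $$ p)"
proof -
  have adj: "mat_adjoint A = Matrix.mat m n (\<lambda>(i, j). cnj (A $$ (j, i)))"
    using assms by (intro eq_matI) (auto simp: mat_adjoint_def mat_of_rows_def)
  have "sample_covariance A \<in> carrier_mat m m"
    using assms by (auto simp: sample_covariance_def adj)
  moreover have "sample_covariance A $$ (j, k) = (\<Sum>i<n. cnj (A $$ (i, j)) * A $$ (i, k))" if "j < m" "k < m" for j k
    using assms that by (simp add: sample_covariance_def adj scalar_prod_def lessThan_atLeast0)
  ultimately show ?thesis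
    by (intro eq_matI) (auto simp: gram_def scalar_entries_def)
qed

lemma correlation_eq_corr_poly:
  assumes X: "iid_complex_matrix Q M n m X"
    and Q: "real_distribution Q"
    and fourth_moment: "integrable Q (\<lambda>x. x ^ 4)"
    and mean: "prob_space.expectation Q (\<lambda>x. x) = 0"
    and variance: "prob_space.variance Q (\<lambda>x. x) = 1 / 2"
  shows "correlation M X \<mu> \<nu> =
    eval2 (corr_poly (complex_of_real (2 * (prob_space.expectation Q (\<lambda>x. x ^ 4) - 3 / 4))) n m) (\<mu> + \<nu>) (\<mu> * \<nu>)"
proof -
  interpret iid_moments M "\<lambda>p w. X w $$ p" n m "complex_of_real (2 * (prob_space.expectation Q (\<lambda>x. x ^ 4) - 3 / 4))"
    by (rule iid_complex_matrix_moments[OF assms])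
  have dim: "X w \<in> carrier_mat n m" if "w \<in> space M" for w
    using X that by (simp add: iid_complex_matrix_def)
  have "correlation M X \<mu> \<nu> = corr n m id \<mu> \<nu>"
    unfolding correlation_def corr_def det_shift_def
    by (rule Bochner_Integration.integral_cong[OF refl]) (simp only: sample_covariance_eq_gram[OF dim])
  then show ?thesis
    by (simp add: corr_eq_corr_poly)
qed

theorem proposition2p2:
  fixes Q :: "real measure"
    and M :: "nat \<Rightarrow> nat \<Rightarrow> 'w measure"
    and X :: "nat \<Rightarrow> nat \<Rightarrow> 'w \<Rightarrow> complex mat"
    and f :: "nat \<Rightarrow> nat \<Rightarrow> complex"
    and b bstar :: real
    and \<alpha> :: nat
    and \<mu> \<nu> z :: complex
  assumes Q: "real_distribution Q"
    and fourth_moment: "integrable Q (\<lambda>x. x ^ 4)"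
    and mean: "prob_space.expectation Q (\<lambda>x. x) = 0"
    and variance: "prob_space.variance Q (\<lambda>x. x) = 1 / 2"
    and b: "b = prob_space.expectation Q (\<lambda>x. x ^ 4)"
    and bstar: "bstar = 2 * (b - 3 / 4)"
    and X: "\<And>n m. m \<le> n \<Longrightarrow> iid_complex_matrix Q (M n m) n m (X n m)"
    and f: "\<And>n m. m \<le> n \<Longrightarrow> f n m = correlation (M n m) (X n m) \<mu> \<nu>"
    and z: "norm z < 1"
  shows "summable (\<lambda>k. (\<mu> * \<nu> * z) ^ k / (fact (k + \<alpha>) * fact k)
           * (1 - z) powi (- 2 * int k - int \<alpha> - 2))
     \<and> (\<lambda>m. f (m + \<alpha>) m / (fact (m + \<alpha>) * fact m) * z ^ m) sums
         (exp (- (\<mu> + \<nu>) * (z / (1 - z)) + of_real bstar * z)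
           * (\<Sum>k. (\<mu> * \<nu> * z) ^ k / (fact (k + \<alpha>) * fact k)
               * (1 - z) powi (- 2 * int k - int \<alpha> - 2)))"
proof -
  define s p \<beta> where "s = \<mu> + \<nu>" and "p = \<mu> * \<nu>" and "\<beta> = complex_of_real bstar"
  have pow: "(1 - z) powi (- 2 * int k - int \<alpha> - 2) = 1 / (1 - z) ^ (\<alpha> + 2 * k + 2)" for k
  proof -
    have "- 2 * int k - int \<alpha> - 2 = - int (\<alpha> + 2 * k + 2)" by simp
    then show ?thesis
      by (simp only: power_int_minus power_int_of_nat inverse_eq_divide)
  qed
  \<comment> \<open>Each pair (m + \<alpha>, m) may have its own probability space; the correlation
    depends only on the dimensions, \<mu>, \<nu> and \<beta>, so the values fit into one
    sequence.\<close>
  have corr: "f (m + \<alpha>) m = eval2 (corr_poly \<beta> (m + \<alpha>) m) s p" for m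
    using f[of m "m + \<alpha>"] correlation_eq_corr_poly[OF X[of m "m + \<alpha>"] Q fourth_moment mean variance]
    by (simp add: s_def p_def \<beta>_def bstar b)
  have exponent: "- (\<mu> + \<nu>) * (z / (1 - z)) + of_real bstar * z = - s * (z / (1 - z)) + \<beta> * z"
    by (simp add: s_def \<beta>_def)
  show ?thesis
    unfolding pow corr exponent p_def[symmetric]
    by (intro conjI corr_poly_gen_fun z)
qed

end
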